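(* Let $N\ge 1$ be a squarefree integer and let $k\geq 4$ be an integer. Suppose that for every divisor $M\mid N$ and every $\phi\in\mathscr{L}(M)$, all nontrivial zeros of $L(\phi,s)$ have real part equal to $\frac12$. Put $$\alpha = 2605+87k+(248+6k)\log(N),\qquad s_{N}=\dim\mathscr{S}_{k}(\Gamma_0(N)),\qquad \epsilon_{N}=\dim\mathscr{E}_{k}(\Gamma_0(N)).$$ Then $$\mathbb{T}_{k}(\Gamma_0(N))=\mathrm{Span}_{\mathbb{C}}\left\{T_1,\dots,T_n\right\}$$ whenever $n$ is an integer with $n \geq NX$ for some real number $X$ such that \begin{align*} X&\geq \max\{6(k+1)^2,\,N,\,17.33\},\\ \frac{X}{\log^4(X)}&\geq 60 k (\alpha+1)^2 (\epsilon_{N}+1)(s_{N}+1)\log(\epsilon_{N}+3)\log(s_{N}+3),\\ \frac{X^{1/2}}{\log^2(X)}&\geq \max\{12(\alpha+1)s_{N}\log(s_{N}+3),\;k\epsilon_{N} (\alpha+1)^2+1\},\\ \frac{X^{k/2}}{\log^2(X)}&\geq 24k (\alpha+1)(\epsilon_{N}+1)\log(\epsilon_{N}+3). \end{align*}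
   Context: $\mathscr{M}_k(\Gamma_0(N))$ is the space of modular forms of weight $k$ on $\Gamma_0(N)$ (trivial nebentypus), with cuspidal subspace $\mathscr{S}_k(\Gamma_0(N))$ and Eisenstein subspace $\mathscr{E}_k(\Gamma_0(N))$. $\mathbb{T}_k(\Gamma_0(N))$ is the $\mathbb{C}$-algebra of Hecke operators $T_n$ ($n\ge1$) acting on the full space $\mathscr{M}_k(\Gamma_0(N))$. $\mathscr{S}_k^{new}(\Gamma_0(d))$ is the space of cuspidal newforms of level $d$. For a positive squarefree integer $M$, $\mathscr{L}(M)$ is the set consisting of: (1) all $\mathrm{Sym}^2 f$, for $f$ in the Hecke eigenbases (normalised newforms) of $\mathscr{S}_k^{new}(\Gamma_0(d))$, $d\mid M$; (2) all $f\otimes g$, for $f\neq g$ distinct forms in the union over $d\mid M$ of these eigenbases; (3) all primitive Dirichlet characters $\chi$ of conductor $d>1$ dividing $M$; (4) all $f\otimes\chi$, for $\chi$ a primitive Dirichlet character of conductor dividing $M$ and $f$ in one of these eigenbases. For a newform $f=\sum a_n(f) q^n$ of level $N_f$ and weight $k$, let $\alpha_{f,1}(p),\alpha_{f,2}(p)$ be the normalised local parameters: $\alpha_{f,1}(p)+\alpha_{f,2}(p)=a_p(f)p^{-(k-1)/2}$, with $\alpha_{f,1}(p)\alpha_{f,2}(p)=1$ if $p\nmid N_f$ and $\alpha_{f,2}(p)=0$ if $p\mid N_f$. The $L$-functions (analytic normalisation) are $L(\mathrm{Sym}^2f,s)=\prod_p[(1-\alpha_{f,1}(p)^2p^{-s})(1-\alpha_{f,1}(p)\alpha_{f,2}(p)p^{-s})(1-\alpha_{f,2}(p)^2p^{-s})]^{-1}$;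 $L(f\otimes g,s)=\prod_p\prod_{1\le i,j\le2}(1-\alpha_{f,i}(p)\alpha_{g,j}(p)p^{-s})^{-1}$; $L(\chi,s)=\prod_p(1-\chi(p)p^{-s})^{-1}$; $L(f\otimes\chi,s)=\prod_p[(1-\chi(p)\alpha_{f,1}(p)p^{-s})(1-\chi(p)\alpha_{f,2}(p)p^{-s})]^{-1}$, each continued analytically. Nontrivial zeros are the zeros with $0<\mathrm{Re}(s)<1$. *)

theory Defs
  imports
    "HOL-Analysis.Analysis"
    "HOL-Computational_Algebra.Squarefree"
    "HOL-Library.Function_Algebras"
begin

(* Forms on the upper half-plane are total functions on the complex numbers that vanish
   off the half-plane, so that equality of forms is equality of functions.
   Likewise, operators on a space of forms are extended by 0 off that space. *)

type_synonym form = "complex \<Rightarrow> complex"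

definition upper_half_plane :: "complex set" where
  "upper_half_plane = {z. Im z > 0}"

definition fscale :: "complex \<Rightarrow> form \<Rightarrow> form" where
  "fscale c f = (\<lambda>z. c * f z)"

definition opscale :: "complex \<Rightarrow> (form \<Rightarrow> form) \<Rightarrow> (form \<Rightarrow> form)" where
  "opscale c T = (\<lambda>f. fscale c (T f))"

global_interpretation form_space: vector_space fscale
  by unfold_locales (auto simp: fscale_def fun_eq_iff algebra_simps)

global_interpretation operator_space: vector_space opscale
  by unfold_locales (auto simp: opscale_def fscale_def fun_eq_iff algebra_simps)

definition SL2Z :: "(int^2^2) set" where
  "SL2Z = {A. det A = 1}"

definition Gamma0 :: "nat \<Rightarrow> (int^2^2) set" where
  "Gamma0 N = {A \<in> SL2Z. int N dvd A $ 2 $ 1}"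

definition automorphy_factor :: "int^2^2 \<Rightarrow> complex \<Rightarrow> complex" where
  "automorphy_factor A z = of_int (A $ 2 $ 1) * z + of_int (A $ 2 $ 2)"

definition moebius_action :: "int^2^2 \<Rightarrow> complex \<Rightarrow> complex" where
  "moebius_action A z =
     (of_int (A $ 1 $ 1) * z + of_int (A $ 1 $ 2)) / automorphy_factor A z"

definition slash :: "nat \<Rightarrow> form \<Rightarrow> int^2^2 \<Rightarrow> form" where
  "slash k f A = (\<lambda>z. f (moebius_action A z) / automorphy_factor A z ^ k)"

(* h is a period of f; the expansion is in powers of exp (2 pi i z / h). *)
definition has_fourier_expansion :: "nat \<Rightarrow> form \<Rightarrow> (nat \<Rightarrow> complex) \<Rightarrow> bool" where
  "has_fourier_expansion h f a \<longleftrightarrow>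
     (\<forall>z\<in>upper_half_plane.
        (\<lambda>n. a n * exp (2 * of_real pi * \<i> * of_nat n * z / of_nat h)) sums f z)"

(* For A in SL2(Z), slash k f A is invariant under A^-1 Gamma0(N) A, which contains Gamma(N).
   So N is a period at every cusp, though not always the least one. *)
definition modular_forms :: "nat \<Rightarrow> nat \<Rightarrow> form set" where
  "modular_forms k N =
     {f. f holomorphic_on upper_half_plane \<and>
         (\<forall>z. z \<notin> upper_half_plane \<longrightarrow> f z = 0) \<and>
         (\<forall>A\<in>Gamma0 N. \<forall>z\<in>upper_half_plane. slash k f A z = f z) \<and>
         (\<forall>A\<in>SL2Z. \<exists>a. has_fourier_expansion N (slash k f A) a)}"

definition cusp_forms :: "nat \<Rightarrow> nat \<Rightarrow> form set" where
  "cusp_forms k N =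
     {f \<in> modular_forms k N.
        \<forall>A\<in>SL2Z. \<exists>a. has_fourier_expansion N (slash k f A) a \<and> a 0 = 0}"

definition fourier_coeff :: "form \<Rightarrow> nat \<Rightarrow> complex" where
  "fourier_coeff f = (THE a. has_fourier_expansion 1 f a)"

definition fundamental_domain :: "complex set" where
  "fundamental_domain = {z \<in> upper_half_plane. \<bar>Re z\<bar> \<le> 1/2 \<and> 1 \<le> cmod z}"

definition Gamma0_cosets :: "nat \<Rightarrow> (int^2^2) set set" where
  "Gamma0_cosets N = (\<lambda>A. (\<lambda>B. B ** A) ` Gamma0 N) ` SL2Z"

(* The integral of f(w) cnj(g(w)) Im(w)^k dx dy / Im(w)^2 over Gamma0(N)\H (not divided
   by the volume).  The measure is SL2(Z)-invariant, so the integral is the sum over the cosets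
   Gamma0(N) A of the integrals over A(fundamental_domain), pulled back along A.
   The summand does not depend on the representative A. *)
definition petersson :: "nat \<Rightarrow> nat \<Rightarrow> form \<Rightarrow> form \<Rightarrow> complex" where
  "petersson k N f g =
     (\<Sum>C\<in>Gamma0_cosets N.
        LINT z:fundamental_domain|lborel.
          (let w = moebius_action (SOME A. A \<in> C) z
           in f w * cnj (g w) * of_real (Im w ^ k)) / of_real (Im z ^ 2))"

definition eisenstein_space :: "nat \<Rightarrow> nat \<Rightarrow> form set" where
  "eisenstein_space k N =
     {f \<in> modular_forms k N. \<forall>g\<in>cusp_forms k N. petersson k N f g = 0}"

definition hecke :: "nat \<Rightarrow> nat \<Rightarrow> nat \<Rightarrow> form \<Rightarrow> form" where
  "hecke k N n f = (\<lambda>z.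
     of_nat n ^ (k - 1) *
     (\<Sum>a | a dvd n \<and> coprime a N.
        let d = n div a
        in \<Sum>b<d. f ((of_nat a * z + of_nat b) / of_nat d) / of_nat d ^ k))"

definition hecke_op :: "nat \<Rightarrow> nat \<Rightarrow> nat \<Rightarrow> form \<Rightarrow> form" where
  "hecke_op k N n = (\<lambda>f. if f \<in> modular_forms k N then hecke k N n f else 0)"

(* The identity of the space is the generator for n = 1. *)
inductive_set hecke_algebra :: "nat \<Rightarrow> nat \<Rightarrow> (form \<Rightarrow> form) set" for k N where
  generator: "n \<ge> 1 \<Longrightarrow> hecke_op k N n \<in> hecke_algebra k N"
| scale: "S \<in> hecke_algebra k N \<Longrightarrow> opscale c S \<in> hecke_algebra k N"
| add: "S \<in> hecke_algebra k N \<Longrightarrow> T \<in> hecke_algebra k N \<Longrightarrow> S + T \<in> hecke_algebra k N"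
| mult: "S \<in> hecke_algebra k N \<Longrightarrow> T \<in> hecke_algebra k N \<Longrightarrow> S \<circ> T \<in> hecke_algebra k N"

definition cusp_forms_old :: "nat \<Rightarrow> nat \<Rightarrow> form set" where
  "cusp_forms_old k d = form_space.span
     {(\<lambda>z. f (of_nat e * z)) |f m e. m * e dvd d \<and> m < d \<and> f \<in> cusp_forms k m}"

definition cusp_forms_new :: "nat \<Rightarrow> nat \<Rightarrow> form set" where
  "cusp_forms_new k d =
     {f \<in> cusp_forms k d. \<forall>g\<in>cusp_forms_old k d. petersson k d f g = 0}"

definition newforms :: "nat \<Rightarrow> nat \<Rightarrow> form set" where
  "newforms k d =
     {f \<in> cusp_forms_new k d.
        fourier_coeff f 1 = 1 \<and> (\<forall>n\<ge>1. \<exists>c. hecke k d n f = fscale c f)}"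

definition dirichlet_character :: "nat \<Rightarrow> (nat \<Rightarrow> complex) \<Rightarrow> bool" where
  "dirichlet_character q \<psi> \<longleftrightarrow>
     (\<forall>m n. \<psi> (m * n) = \<psi> m * \<psi> n) \<and>
     (\<forall>n. \<psi> (n + q) = \<psi> n) \<and>
     (\<forall>n. \<psi> n \<noteq> 0 \<longleftrightarrow> coprime n q)"

definition primitive_character :: "nat \<Rightarrow> (nat \<Rightarrow> complex) \<Rightarrow> bool" where
  "primitive_character q \<psi> \<longleftrightarrow>
     q \<ge> 1 \<and> dirichlet_character q \<psi> \<and>
     (\<forall>d. d dvd q \<and> d < q \<longrightarrow> (\<exists>n. coprime n q \<and> n mod d = 1 mod d \<and> \<psi> n \<noteq> 1))"

(* Each form is preceded by its level. *)
datatype L_datum =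
    Sym2 nat form
  | Tensor nat form nat form
  | Character "nat \<Rightarrow> complex"
  | Twist nat form "nat \<Rightarrow> complex"

definition L_family :: "nat \<Rightarrow> nat \<Rightarrow> L_datum set" where
  "L_family k M =
     {Sym2 d f |d f. d dvd M \<and> f \<in> newforms k d} \<union>
     {Tensor d f e g |d f e g.
        d dvd M \<and> f \<in> newforms k d \<and> e dvd M \<and> g \<in> newforms k e \<and> f \<noteq> g} \<union>
     {Character \<psi> |d \<psi>. d > 1 \<and> d dvd M \<and> primitive_character d \<psi>} \<union>
     {Twist d f \<psi> |d f e \<psi>.
        d dvd M \<and> f \<in> newforms k d \<and> e dvd M \<and> primitive_character e \<psi>}"

(* The order of the two parameters is unspecified when p does not divide the level;
   the Euler factors below are symmetric in them. *)
definition local_params :: "nat \<Rightarrow> nat \<Rightarrow> form \<Rightarrow> nat \<Rightarrow> complex \<times> complex" where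
  "local_params k d f p = (SOME (x, y).
     x + y = fourier_coeff f p * of_real (real p powr (- (real k - 1) / 2)) \<and>
     (if p dvd d then y = 0 else x * y = 1))"

fun euler_factor :: "nat \<Rightarrow> L_datum \<Rightarrow> nat \<Rightarrow> complex \<Rightarrow> complex" where
  "euler_factor k (Sym2 d f) p s =
     (let (x, y) = local_params k d f p; q = of_nat p powr (-s)
      in inverse ((1 - x^2 * q) * (1 - x * y * q) * (1 - y^2 * q)))"
| "euler_factor k (Tensor d f e g) p s =
     (let (x, y) = local_params k d f p; (u, v) = local_params k e g p; q = of_nat p powr (-s)
      in inverse ((1 - x * u * q) * (1 - x * v * q) * (1 - y * u * q) * (1 - y * v * q)))"
| "euler_factor k (Character \<psi>) p s = inverse (1 - \<psi> p * of_nat p powr (-s))"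
| "euler_factor k (Twist d f \<psi>) p s =
     (let (x, y) = local_params k d f p; q = of_nat p powr (-s)
      in inverse ((1 - \<psi> p * x * q) * (1 - \<psi> p * y * q)))"

definition euler_product :: "nat \<Rightarrow> L_datum \<Rightarrow> complex \<Rightarrow> complex" where
  "euler_product k \<phi> s = (\<Prod>p. if prime p then euler_factor k \<phi> p s else 1)"

(* For squarefree M, the continuations for the members of L_family k M are entire:
   the trivial character and the products of a form with itself are excluded, and
   no newform of squarefree level has complex multiplication. *)
definition L_function :: "nat \<Rightarrow> L_datum \<Rightarrow> complex \<Rightarrow> complex" where
  "L_function k \<phi> =
     (THE F. F holomorphic_on UNIV \<and> (\<forall>s. Re s > 1 \<longrightarrow> F s = euler_product k \<phi> s))"

end

theory Submission
  imports Defs "HOL-Complex_Analysis.Complex_Analysis" "HOL-Number_Theory.Cong"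
begin

text \<open>Write \<open>a\<^sub>j(f)\<close> for the Fourier coefficients of \<open>f\<close> at infinity. The hypotheses on \<open>X\<close> place \<open>n\<close>
  above a bound beyond which \<open>a\<^sub>1, \<dots>, a\<^sub>n\<close> determine a form of weight \<open>k\<close> on \<open>\<Gamma>\<^sub>0(N)\<close>, constant term
  included, and this forces \<open>T\<^sub>1, \<dots>, T\<^sub>n\<close> to span.

  The last implication is duality. For \<open>U\<close> in the Hecke algebra, the functional \<open>f \<mapsto> a\<^sub>1(U f)\<close>
  vanishes on the common kernel of \<open>a\<^sub>1, \<dots>, a\<^sub>n\<close>, which is zero, so it equals \<open>\<Sum> c\<^sub>i a\<^sub>i\<close> for some
  constants. As \<open>U\<close> commutes with \<open>T\<^sub>r\<close>, and as \<open>a\<^sub>i(T\<^sub>r f) = a\<^sub>r(T\<^sub>i f)\<close>, applying this to \<open>T\<^sub>r f\<close>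
  gives \<open>a\<^sub>r(U f) = \<Sum> c\<^sub>i a\<^sub>r(T\<^sub>i f)\<close> for all \<open>r \<ge> 1\<close>, and hence \<open>U = \<Sum> c\<^sub>i T\<^sub>i\<close>
  (\<open>hecke_algebra_eq_span\<close>). This needs the stability of the space of modular forms under the Hecke
  operators (\<open>hecke_modular_form\<close>), their effect on coefficients (\<open>hecke_expansion\<close>) and their
  commutativity (\<open>hecke_seq_commute\<close>).

  That the first coefficients determine a form is a bound of Sturm type, obtained by Siegel's method
  (\<open>sturm_bound\<close>). The product \<open>F\<close> of the finitely many \<open>SL\<^sub>2(\<int>)\<close>-conjugates of \<open>h\<close> has
  level one and some weight \<open>K\<close>, so \<open>|F(z)|\<^sup>2 (Im z)\<^sup>K\<close> is invariant under \<open>SL\<^sub>2(\<int>)\<close>, and its supremum is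
  approached on \<open>Im z \<ge> 1/5\<close>. If \<open>h\<close> vanishes at infinity to high order, the maximum
  principle in the coordinate \<open>exp (2\<pi>iz/M)\<close>, applied on the disc that corresponds to
  \<open>Im z \<ge> 1/10\<close>, bounds that supremum by a proper fraction of itself; so it is zero. To also
  kill a constant term the bound is applied to \<open>h(z) = f(z) - f(2z)\<close>, of level \<open>2N\<close>
  (\<open>modular_form_zero_of_coeffs\<close>). If \<open>h = 0\<close>, then \<open>f\<close> is constant, and so zero.

  The number of conjugates is at most the index of \<open>\<Gamma>\<^sub>0(2N)\<close>, which is at most
  \<open>2N (2 ln (2N) + 1)\<close> (\<open>covers_cosets_card_le\<close>). The second condition on \<open>X\<close> gives
  \<open>X \<ge> 60 k (\<alpha> + 1)\<^sup>2\<close>, where \<open>\<alpha>\<close> exceeds \<open>248 ln N\<close>, so \<open>N X\<close> exceeds \<open>k\<close> times this bound.\<close>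

section \<open>Integral matrices acting on the upper half-plane\<close>

abbreviation \<H> :: "complex set" where "\<H> \<equiv> upper_half_plane"

lemma mem_H [simp]: "z \<in> \<H> \<longleftrightarrow> Im z > 0"
  by (simp add: upper_half_plane_def)

definition mat2 :: "int \<Rightarrow> int \<Rightarrow> int \<Rightarrow> int \<Rightarrow> int^2^2" where
  "mat2 a b c d = vector [vector [a, b], vector [c, d]]"

lemma mat2_nth [simp]:
  "mat2 a b c d $ 1 $ 1 = a" "mat2 a b c d $ 1 $ 2 = b"
  "mat2 a b c d $ 2 $ 1 = c" "mat2 a b c d $ 2 $ 2 = d"
  by (simp_all add: mat2_def)

lemma mat2_eqI:
  fixes A B :: "int^2^2"
  assumes "A$1$1 = B$1$1" "A$1$2 = B$1$2" "A$2$1 = B$2$1" "A$2$2 = B$2$2"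
  shows "A = B"
  using assms by (simp add: vec_eq_iff forall_2)

lemma mat2_eq_iff [simp]:
  "mat2 a b c d = mat2 a' b' c' d' \<longleftrightarrow> a = a' \<and> b = b' \<and> c = c' \<and> d = d'"
  by (metis mat2_nth)

lemma mat2_cases: obtains a b c d where "A = mat2 a b c d"
  by (rule that, rule mat2_eqI) auto

lemma mat2_mult [simp]:
  "mat2 a b c d ** mat2 a' b' c' d' =
     mat2 (a*a' + b*c') (a*b' + b*d') (c*a' + d*c') (c*b' + d*d')"
  by (rule mat2_eqI) (simp_all add: matrix_matrix_mult_def sum_2)

lemma det_mat2 [simp]: "det (mat2 a b c d) = a*d - b*c"
  by (simp add: det_2)

lemma mat2_in_SL2Z [simp]: "mat2 a b c d \<in> SL2Z \<longleftrightarrow> a*d - b*c = 1"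
  by (simp add: SL2Z_def)

lemma mat2_in_Gamma0 [simp]:
  "mat2 a b c d \<in> Gamma0 N \<longleftrightarrow> a*d - b*c = 1 \<and> int N dvd c"
  by (simp add: Gamma0_def)

lemma SL2Z_mult: "A \<in> SL2Z \<Longrightarrow> B \<in> SL2Z \<Longrightarrow> A ** B \<in> SL2Z"
  by (simp add: SL2Z_def det_mul)

lemma Gamma0_mult:
  assumes "A \<in> Gamma0 N" "B \<in> Gamma0 N"
  shows "A ** B \<in> Gamma0 N"
proof -
  obtain a b c d where A: "A = mat2 a b c d" by (rule mat2_cases)
  obtain a' b' c' d' where B: "B = mat2 a' b' c' d'" by (rule mat2_cases)
  have "A ** B \<in> SL2Z"
    using assms by (intro SL2Z_mult) (auto simp: Gamma0_def)
  thus ?thesis using assms unfolding A B by (simp add: SL2Z_def)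
qed

lemma Gamma0_subset_SL2Z: "A \<in> Gamma0 N \<Longrightarrow> A \<in> SL2Z"
  by (simp add: Gamma0_def)

lemma Gamma0_1 [simp]: "Gamma0 (Suc 0) = SL2Z"
  by (auto simp: Gamma0_def)

text \<open>The adjugate, which is the inverse on \<open>SL\<^sub>2(\<int>)\<close> and stays within integral matrices.\<close>

definition adj2 :: "int^2^2 \<Rightarrow> int^2^2" where
  "adj2 A = mat2 (A$2$2) (- (A$1$2)) (- (A$2$1)) (A$1$1)"

lemma adj2_mat2 [simp]: "adj2 (mat2 a b c d) = mat2 d (-b) (-c) a"
  by (simp add: adj2_def)

lemma mat1_eq_mat2: "(mat 1 :: int^2^2) = mat2 1 0 0 1"
  by (rule mat2_eqI) (simp_all add: mat_def)

lemma adj2_SL2Z: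
  assumes "A \<in> SL2Z"
  shows "adj2 A \<in> SL2Z" "A ** adj2 A = mat 1" "adj2 A ** A = mat 1"
proof -
  obtain a b c d where A: "A = mat2 a b c d" by (rule mat2_cases)
  show "adj2 A \<in> SL2Z" "A ** adj2 A = mat 1" "adj2 A ** A = mat 1"
    using assms unfolding A mat1_eq_mat2 by (auto simp: algebra_simps)
qed

lemma adj2_Gamma0: "A \<in> Gamma0 N \<Longrightarrow> adj2 A \<in> Gamma0 N"
  by (rule mat2_cases[of A]) (auto simp: algebra_simps)

lemma Im_automorphy_nz:
  assumes "det A > 0" "Im z > 0"
  shows "automorphy_factor A z \<noteq> 0"
proof
  obtain a b c d where A: "A = mat2 a b c d" by (rule mat2_cases)
  assume "automorphy_factor A z = 0"
  hence *: "of_int c * z + of_int d = 0" by (simp add: A automorphy_factor_def)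
  have "of_int c * Im z = 0" using arg_cong[OF *, of Im] by simp
  hence "c = 0" using assms by simp
  with * have "d = 0" by simp
  with \<open>c = 0\<close> assms show False by (simp add: A)
qed

lemma Im_moebius:
  assumes "det A > 0" "Im z > 0"
  shows "Im (moebius_action A z) = of_int (det A) * Im z / norm (automorphy_factor A z) ^ 2"
proof -
  obtain a b c d where A: "A = mat2 a b c d" by (rule mat2_cases)
  show ?thesis
    unfolding A moebius_action_def Im_divide cmod_power2
    by (simp add: automorphy_factor_def power2_eq_square algebra_simps)
qed

lemma moebius_in_H:
  assumes "det A > 0" "Im z > 0"
  shows "Im (moebius_action A z) > 0"
  using Im_moebius[OF assms] Im_automorphy_nz[OF assms] assms by simp

lemma automorphy_mult:
  assumes "det B > 0" "Im z > 0"
  shows "automorphy_factor (A ** B) z =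
           automorphy_factor A (moebius_action B z) * automorphy_factor B z"
proof -
  obtain a b c d where A: "A = mat2 a b c d" by (rule mat2_cases)
  obtain a' b' c' d' where B: "B = mat2 a' b' c' d'" by (rule mat2_cases)
  have nz: "of_int c' * z + of_int d' \<noteq> 0"
    using Im_automorphy_nz[OF assms] by (simp add: automorphy_factor_def B)
  show ?thesis using nz unfolding A B
    by (simp add: automorphy_factor_def moebius_action_def field_simps)
qed

lemma moebius_mult:
  assumes "det A > 0" "det B > 0" "Im z > 0"
  shows "moebius_action (A ** B) z = moebius_action A (moebius_action B z)"
proof -
  obtain a b c d where A: "A = mat2 a b c d" by (rule mat2_cases)
  obtain a' b' c' d' where B: "B = mat2 a' b' c' d'" by (rule mat2_cases)
  have nz: "of_int c' * z + of_int d' \<noteq> 0"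
    using Im_automorphy_nz[OF assms(2,3)] by (simp add: automorphy_factor_def B)
  let ?n = "of_int c' * z + of_int d'" and ?w = "moebius_action B z"
  have num: "of_int a * ?w + of_int b
        = (of_int (a*a' + b*c') * z + of_int (a*b' + b*d')) / ?n"
    using nz by (simp add: B moebius_action_def automorphy_factor_def field_simps)
  have den: "automorphy_factor (A ** B) z = automorphy_factor A ?w * ?n"
    using automorphy_mult[OF assms(2,3), of A] by (simp add: B automorphy_factor_def)
  have "moebius_action (A ** B) z =
          (of_int (a*a' + b*c') * z + of_int (a*b' + b*d')) / (?n * automorphy_factor A ?w)"
    unfolding moebius_action_def[of "A ** B"] den by (simp add: A B mult.commute)
  also have "\<dots> = (of_int a * ?w + of_int b) / automorphy_factor A ?w"
    unfolding num by simp
  also have "\<dots> = moebius_action A ?w"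
    by (simp add: moebius_action_def A)
  finally show ?thesis .
qed

text \<open>The slash operators form a right action. No power of the determinant enters the normalisation, so this
  holds for all integral matrices of positive determinant, which is what Hecke operators require.\<close>

lemma slash_slash:
  assumes "det A > 0" "det B > 0" "Im z > 0"
  shows "slash k (slash k f A) B z = slash k f (A ** B) z"
  using assms by (simp add: slash_def moebius_mult automorphy_mult power_mult_distrib)

lemma slash_cong:
  assumes "\<And>z. Im z > 0 \<Longrightarrow> f z = g z" "det A > 0" "Im z > 0"
  shows "slash k f A z = slash k g A z"
  using assms by (simp add: slash_def moebius_in_H)

lemma det_SL2Z: "A \<in> SL2Z \<Longrightarrow> det A = 1"
  by (simp add: SL2Z_def)

lemma det_Gamma0: "A \<in> Gamma0 N \<Longrightarrow> det A = 1"
  by (simp add: Gamma0_def SL2Z_def)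

lemma slash_mat1 [simp]: "slash k f (mat 1) = f"
  by (simp add: slash_def fun_eq_iff moebius_action_def automorphy_factor_def mat1_eq_mat2)

lemma slash_upper:
  "slash k f (mat2 a b 0 d) z = f ((of_int a * z + of_int b) / of_int d) / of_int d ^ k"
  by (simp add: slash_def moebius_action_def automorphy_factor_def)

lemma slash_sum:
  "slash k (\<lambda>z. \<Sum>i\<in>I. f i z) A z = (\<Sum>i\<in>I. slash k (f i) A z)"
  by (simp add: slash_def sum_divide_distrib)

lemma slash_scale: "slash k (\<lambda>z. c * f z) A z = c * slash k f A z"
  by (simp add: slash_def)

lemma holomorphic_slash:
  assumes "f holomorphic_on \<H>" "det A > 0"
  shows "slash k f A holomorphic_on \<H>"
proof -
  have *: "(\<lambda>z. automorphy_factor A z) holomorphic_on \<H>" 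
    unfolding automorphy_factor_def by (intro holomorphic_intros)
  have "moebius_action A holomorphic_on \<H>"
    unfolding moebius_action_def using * Im_automorphy_nz[OF assms(2)]
    by (intro holomorphic_intros) auto
  hence **: "(f \<circ> moebius_action A) holomorphic_on \<H>"
    by (rule holomorphic_on_compose_gen[OF _ assms(1)])
       (use moebius_in_H[OF assms(2)] in auto)
  have "(\<lambda>z. (f \<circ> moebius_action A) z / automorphy_factor A z ^ k) holomorphic_on \<H>"
    using Im_automorphy_nz[OF assms(2)]
    by (intro holomorphic_on_divide holomorphic_on_power * **) auto
  thus ?thesis by (simp add: slash_def[abs_def] o_def)
qed

section \<open>Fourier expansions as power series in the disc\<close>

definition qpar :: "nat \<Rightarrow> complex \<Rightarrow> complex" where
  "qpar h z = exp (2 * of_real pi * \<i> * z / of_nat h)"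

lemma qpar_power: "qpar h z ^ n = exp (2 * of_real pi * \<i> * of_nat n * z / of_nat h)"
  unfolding qpar_def by (subst exp_of_nat_mult [symmetric]) (simp add: algebra_simps)

lemma has_fourier_expansion_qpar:
  "has_fourier_expansion h f a \<longleftrightarrow> (\<forall>z. Im z > 0 \<longrightarrow> (\<lambda>n. a n * qpar h z ^ n) sums f z)"
  by (simp add: has_fourier_expansion_def qpar_power Ball_def)

lemma norm_qpar: "norm (qpar h z) = exp (- 2 * pi * Im z / real h)"
  unfolding qpar_def norm_exp_eq_Re by (simp add: Re_divide_of_nat)

lemma qpar_surj:
  assumes "w \<noteq> 0" "norm w < 1" "h > 0"
  obtains z where "Im z > 0" "qpar h z = w"
proof
  let ?z = "of_nat h * Ln w / (2 * of_real pi * \<i>)"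
  show eq: "qpar h ?z = w" using assms by (simp add: qpar_def)
  have "exp (- 2 * pi * Im ?z / real h) < 1" using assms(2) eq norm_qpar[of h ?z] by simp
  thus "Im ?z > 0" using assms(3) by (simp add: field_simps zero_less_mult_iff)
qed

lemma qpar_mult: "m > 0 \<Longrightarrow> qpar (m * h) z ^ m = qpar h z"
  by (simp add: qpar_power) (simp add: qpar_def field_simps)

text \<open>Every point of the punctured unit disc is a value of \<open>qpar h\<close>, so an expansion valid on the half-plane
  is a power series converging on the whole disc. Growth conditions at a cusp thereby become holomorphy at \<open>0\<close>.\<close>

lemma fourier_expansion_disc:
  assumes "has_fourier_expansion h f a" "h > 0"
  obtains g where "g holomorphic_on ball 0 1"
    "\<And>w. norm w < 1 \<Longrightarrow> (\<lambda>n. a n * w ^ n) sums g w"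
    "\<And>z. Im z > 0 \<Longrightarrow> f z = g (qpar h z)"
proof -
  define g where "g = (\<lambda>w. \<Sum>n. a n * w ^ n)"
  have sums: "(\<lambda>n. a n * w ^ n) sums g w" if w1: "norm w < 1" for w
  proof (cases "w = 0")
    case True
    have "(\<lambda>n. a n * w ^ n) sums a 0" unfolding True by (rule powser_sums_zero)
    thus ?thesis by (simp add: g_def sums_iff)
  next
    case False
    then obtain z where z: "Im z > 0" "qpar h z = w"
      using qpar_surj w1 assms(2) by blast
    have "(\<lambda>n. a n * w ^ n) sums f z"
      using assms(1) z by (auto simp: has_fourier_expansion_qpar)
    thus ?thesis by (simp add: g_def sums_iff)
  qed
  have "g holomorphic_on ball 0 1"
    by (rule power_series_holomorphic[of 0 1 a]) (use sums in auto)
  moreover have "f z = g (qpar h z)" if "Im z > 0" for z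
  proof -
    have "norm (qpar h z) < 1" using that assms(2) by (simp add: norm_qpar)
    from sums[OF this] show ?thesis
      using assms(1) that sums_unique2 by (auto simp: has_fourier_expansion_qpar)
  qed
  ultimately show thesis using sums that by blast
qed

lemma fourier_expansion_zero:
  assumes "has_fourier_expansion h f a" "h > 0" "\<And>z. Im z > 0 \<Longrightarrow> f z = 0"
  shows "a n = 0"
proof -
  obtain g where g: "\<And>w. norm w < 1 \<Longrightarrow> (\<lambda>n. a n * w ^ n) sums g w"
    "\<And>z. Im z > 0 \<Longrightarrow> f z = g (qpar h z)" "g holomorphic_on ball 0 1"
    using fourier_expansion_disc[OF assms(1,2)] by metis
  have nz: "g w = 0" if "w \<noteq> 0" "norm w < 1" for w
    using qpar_surj[OF that assms(2)] g(2) assms(3) by metis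
  have "(g \<longlongrightarrow> g 0) (at 0)"
    using holomorphic_on_imp_continuous_on[OF g(3)]
    by (simp add: continuous_on_eq_continuous_at isCont_def)
  moreover have "\<forall>\<^sub>F w in at 0. g w = 0"
    unfolding eventually_at by (intro exI[of _ 1]) (use nz in auto)
  hence "(g \<longlongrightarrow> 0) (at 0)" by (simp add: tendsto_eventually)
  ultimately have g0: "g 0 = 0" using tendsto_unique[of "at (0::complex)" g] by auto
  have "a 0 = g 0" using g(1)[of 0] powser_sums_zero[of a] sums_unique2 by fastforce
  show "a n = 0"
  proof (cases "n = 0")
    case False
    show ?thesis
    proof (rule ccontr)
      assume "a n \<noteq> 0"
      then obtain s where "0 < s" "\<And>z. z \<in> cball 0 s - {0} \<Longrightarrow> g z \<noteq> 0"
        using powser_0_nonzero[of 1 0 a g n] g(1) g0 False by auto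
      moreover define r where "r = min s (1/2)"
      hence "0 < r" "r \<le> s" "r < 1" using \<open>0 < s\<close> by auto
      ultimately show False using nz[of "of_real r"] by auto
    qed
  qed (use \<open>a 0 = g 0\<close> g0 in simp)
qed

lemma fourier_expansion_sum:
  assumes "\<And>i. i \<in> I \<Longrightarrow> has_fourier_expansion h (f i) (a i)"
  shows "has_fourier_expansion h (\<lambda>z. \<Sum>i\<in>I. f i z) (\<lambda>n. \<Sum>i\<in>I. a i n)"
  using assms unfolding has_fourier_expansion_qpar sum_distrib_right
  by (intro allI impI sums_sum) auto

lemma fourier_expansion_diff:
  assumes "has_fourier_expansion h f a" "has_fourier_expansion h g b"
  shows "has_fourier_expansion h (\<lambda>z. f z - g z) (\<lambda>n. a n - b n)"
  using assms unfolding has_fourier_expansion_qpar left_diff_distrib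
  by (intro allI impI sums_diff) auto

lemma fourier_expansion_add:
  assumes "has_fourier_expansion h f a" "has_fourier_expansion h g b"
  shows "has_fourier_expansion h (\<lambda>z. f z + g z) (\<lambda>n. a n + b n)"
  using assms unfolding has_fourier_expansion_qpar distrib_right
  by (intro allI impI sums_add) auto

lemma fourier_expansion_scale:
  assumes "has_fourier_expansion h f a"
  shows "has_fourier_expansion h (\<lambda>z. c * f z) (\<lambda>n. c * a n)"
  using assms unfolding has_fourier_expansion_qpar mult.assoc
  by (intro allI impI sums_mult) auto

lemma fourier_expansion_cong:
  assumes "has_fourier_expansion h f a" "\<And>z. Im z > 0 \<Longrightarrow> f z = g z"
  shows "has_fourier_expansion h g a"
  using assms unfolding has_fourier_expansion_qpar by auto

lemma fourier_expansion_unique: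
  assumes "has_fourier_expansion h f a" "has_fourier_expansion h f b" "h > 0"
  shows "a = b"
proof
  fix n
  have "has_fourier_expansion h (\<lambda>z. f z - f z) (\<lambda>n. a n - b n)"
    by (intro fourier_expansion_diff assms)
  from fourier_expansion_zero[OF this \<open>h > 0\<close>, of n] show "a n = b n" by simp
qed

text \<open>The coefficients of \<open>\<Sum> a\<^sub>n q\<^bsup>mn\<^esup>\<close> as a series in \<open>q\<close>.\<close>

definition spread :: "nat \<Rightarrow> (nat \<Rightarrow> complex) \<Rightarrow> nat \<Rightarrow> complex" where
  "spread m a n = (if m dvd n then a (n div m) else 0)"

lemma sums_spread:
  assumes "m > 0"
  shows "(\<lambda>n. spread m a n * w ^ n) sums s \<longleftrightarrow> (\<lambda>n. a n * (w ^ m) ^ n) sums s"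
proof -
  have "strict_mono (\<lambda>n. m * n)" using assms by (simp add: strict_mono_def)
  moreover have "spread m a n * w ^ n = 0" if "n \<notin> range (\<lambda>n. m * n)" for n
    using that by (auto simp: spread_def dvd_def)
  ultimately have "(\<lambda>n. spread m a (m * n) * w ^ (m * n)) sums s \<longleftrightarrow>
      (\<lambda>n. spread m a n * w ^ n) sums s"
    by (rule sums_mono_reindex)
  thus ?thesis using assms by (simp add: spread_def power_mult)
qed

lemma fourier_expansion_rescale:
  assumes "m > 0"
  shows "has_fourier_expansion (m * h) f (spread m a) \<longleftrightarrow> has_fourier_expansion h f a"
  unfolding has_fourier_expansion_qpar sums_spread[OF assms] qpar_mult[OF assms] ..

lemma qpar_translate: "h > 0 \<Longrightarrow> qpar h (z + of_real x) = qpar h z * exp (2 * pi * \<i> * x / h)"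
  unfolding qpar_def exp_add[symmetric] by (simp add: field_simps)

text \<open>Translation by \<open>h\<close> multiplies the \<open>n\<close>-th term by \<open>\<zeta>\<^sup>n\<close>, where \<open>\<zeta>\<close> is a primitive \<open>m\<close>-th root of unity. By
  uniqueness of coefficients, periodicity leaves only the terms with \<open>m dvd n\<close>.\<close>

lemma fourier_expansion_reduce_period:
  assumes "has_fourier_expansion (m * h) f a" "m > 0" "h > 0"
    and per: "\<And>z. Im z > 0 \<Longrightarrow> f (z + of_nat h) = f z"
  shows "has_fourier_expansion h f (\<lambda>n. a (m * n))"
proof -
  define \<zeta> where "\<zeta> = exp (2 * pi * \<i> / m)"
  have q: "qpar (m * h) (z + of_nat h) = qpar (m * h) z * \<zeta>" for z
    using assms(2,3) qpar_translate[of "m * h" z "real h"] by (simp add: \<zeta>_def)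
  have "has_fourier_expansion (m * h) f (\<lambda>n. a n * \<zeta> ^ n)"
    unfolding has_fourier_expansion_qpar
  proof (intro allI impI)
    fix z :: complex assume z: "Im z > 0"
    hence "(\<lambda>n. a n * (qpar (m * h) z * \<zeta>) ^ n) sums f z"
      using assms(1) per[OF z] q[of z] by (auto simp: has_fourier_expansion_qpar dest: spec[of _ "z + of_nat h"])
    thus "(\<lambda>n. a n * \<zeta> ^ n * qpar (m * h) z ^ n) sums f z"
      by (simp add: power_mult_distrib mult_ac)
  qed
  hence "a = (\<lambda>n. a n * \<zeta> ^ n)"
    using assms by (intro fourier_expansion_unique[of "m * h" f]) auto
  hence eq: "a n * (1 - \<zeta> ^ n) = 0" for n
    by (auto dest: fun_cong[of _ _ n] simp: algebra_simps)
  have "a n = 0" if "\<not> m dvd n" for n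
  proof -
    have "\<zeta> ^ n \<noteq> 1"
    proof
      assume "\<zeta> ^ n = 1"
      hence "exp (2 * of_real pi * \<i> * of_nat n / of_nat m) = (1::complex)"
        unfolding \<zeta>_def by (subst (asm) exp_of_nat_mult [symmetric]) (simp add: algebra_simps)
      hence "m dvd n" using complex_root_unity_eq_1[of m n] assms(2) by simp
      thus False using that by simp
    qed
    thus ?thesis using eq[of n] by simp
  qed
  hence "a = spread m (\<lambda>n. a (m * n))" by (auto simp: spread_def fun_eq_iff)
  thus ?thesis using assms(1) fourier_expansion_rescale[OF assms(2)] by metis
qed

lemma fourier_expansion_affine:
  assumes "has_fourier_expansion h f a" "h > 0" "A > 0" "D > 0"
  shows "has_fourier_expansion (D * h) (\<lambda>z. f ((of_nat A * z + of_int b) / of_nat D))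
           (spread A (\<lambda>n. a n * exp (2 * of_real pi * \<i> * of_int b / of_nat (D * h)) ^ n))"
  unfolding has_fourier_expansion_qpar sums_spread[OF assms(3)]
proof (intro allI impI)
  fix z :: complex assume z: "Im z > 0"
  let ?z' = "(of_nat A * z + of_int b) / of_nat D"
  have "qpar h ?z' = qpar (D * h) z ^ A * exp (2 * of_real pi * \<i> * of_int b / of_nat (D * h))"
    unfolding qpar_power unfolding qpar_def exp_add[symmetric] using assms by (simp add: field_simps)
  moreover have "Im ?z' > 0" using z assms by simp
  ultimately have "(\<lambda>n. a n * (qpar (D * h) z ^ A * exp (2 * of_real pi * \<i> * of_int b / of_nat (D * h))) ^ n) sums f ?z'"
    using assms(1) unfolding has_fourier_expansion_qpar by metis
  thus "(\<lambda>n. a n * exp (2 * of_real pi * \<i> * of_int b / of_nat (D * h)) ^ n * (qpar (D * h) z ^ A) ^ n) sums f ?z'"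
    by (simp add: power_mult_distrib mult_ac)
qed

section \<open>The index of \<open>\<Gamma>\<^sub>0(N)\<close>\<close>

text \<open>Repetitions among the cosets \<open>\<Gamma>\<^sub>0(M) r\<close> are allowed, so \<open>card R\<close> bounds the index from above.\<close>

definition covers_cosets :: "nat \<Rightarrow> (int^2^2) set \<Rightarrow> bool" where
  "covers_cosets M R \<longleftrightarrow> finite R \<and> R \<subseteq> SL2Z \<and> (\<forall>A\<in>SL2Z. \<exists>g\<in>Gamma0 M. \<exists>r\<in>R. A = g ** r)"

text \<open>Let \<open>(c, d)\<close> be the bottom row of an element of \<open>\<Gamma>\<^sub>0(m)\<close>. If \<open>p\<close> does not divide \<open>d\<close>, adding to \<open>c\<close> the multiple
  \<open>m j d\<close> for a suitable \<open>j < p\<close> makes it divisible by \<open>p m\<close>. If \<open>p\<close> divides \<open>d\<close>, then \<open>p\<close> does not divide \<open>m\<close>, since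
  \<open>c\<close> and \<open>d\<close> are coprime, and one further representative with bottom row \<open>(m, p)\<close> suffices.\<close>

lemma Gamma0_step:
  assumes p: "prime p" and m: "m > 0"
  obtains S where "finite S" "S \<subseteq> SL2Z" "card S \<le> (if p dvd m then p else p + 1)"
    "\<And>A. A \<in> Gamma0 m \<Longrightarrow> \<exists>g\<in>Gamma0 (p * m). \<exists>s\<in>S. A = g ** s"
proof -
  have p': "prime (int p)" using p by simp
  define T where "T = (\<lambda>j. mat2 1 0 (- int (m * j)) 1) ` {..<p}"
  have T: "finite T" "T \<subseteq> SL2Z" "card T \<le> p"
    using card_image_le[of "{..<p}" "\<lambda>j. mat2 1 0 (- int (m * j)) 1"]
    by (auto simp: T_def)
  have main: "\<exists>g\<in>Gamma0 (p * m). \<exists>s\<in>T. A = g ** s"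
    if A: "A \<in> Gamma0 m" "\<not> int p dvd A$2$2" for A :: "int^2^2"
  proof -
    obtain a b c d where Am: "A = mat2 a b c d" by (rule mat2_cases)
    have abcd: "a * d - b * c = 1" "int m dvd c" "\<not> int p dvd d" using A by (auto simp: Am)
    then obtain c' where c': "c = int m * c'" by (auto simp: dvd_def)
    have "coprime d (int p)"
      using p' abcd(3) by (metis coprime_commute prime_imp_coprime)
    then obtain x where x: "[d * x = 1] (mod int p)" using cong_solve_coprime_int by blast
    define j where "j = nat ((- c' * x) mod int p)"
    have p0: "int p > 0" using prime_gt_0_nat[OF p] by simp
    have j: "int j = (- c' * x) mod int p" "j < p" using p0 by (auto simp: j_def nat_less_iff)
    have "[c' + d * int j = c' + d * (- c' * x)] (mod int p)"
      unfolding j(1) by (intro cong_add cong_mult cong_refl) (simp add: cong_def)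
    also have "c' + d * (- c' * x) = c' - c' * (d * x)" by (simp add: algebra_simps)
    also have "[c' - c' * (d * x) = c' - c' * 1] (mod int p)"
      by (intro cong_diff cong_mult cong_refl x)
    finally have "int p dvd c' + d * int j" by (simp add: cong_0_iff)
    hence "int p * int m dvd int m * (c' + d * int j)" by (simp add: mult.commute)
    hence *: "int (p * m) dvd c + d * int (m * j)" by (simp add: c' algebra_simps)
    have "mat2 (a + b * int (m * j)) b (c + d * int (m * j)) d \<in> Gamma0 (p * m)"
      using * abcd(1) by (simp add: algebra_simps)
    moreover have "A = mat2 (a + b * int (m * j)) b (c + d * int (m * j)) d ** mat2 1 0 (- int (m * j)) 1"
      by (simp add: Am algebra_simps)
    moreover have "mat2 1 0 (- int (m * j)) 1 \<in> T" using j(2) by (auto simp: T_def)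
    ultimately show ?thesis by blast
  qed
  show thesis
  proof (cases "p dvd m")
    case True
    have "\<not> int p dvd A$2$2" if "A \<in> Gamma0 m" for A :: "int^2^2"
    proof
      assume *: "int p dvd A$2$2"
      have "int p dvd int m" using True by simp
      hence "int p dvd A$2$1" using that dvd_trans unfolding Gamma0_def by blast
      hence "int p dvd det A" using * by (simp add: det_2)
      thus False using det_Gamma0[OF that] p' by (metis not_prime_unit)
    qed
    thus thesis using that[of T] T main True by auto
  next
    case False
    hence "coprime (int p) (int m)" using p by (simp add: prime_imp_coprime)
    then obtain u v where uv: "u * int p + v * int m = 1" using bezout_int[of "int p" "int m"] by auto
    define r where "r = mat2 u (- v) (int m) (int p)"
    have r: "r \<in> SL2Z" using uv by (simp add: r_def)
    have "\<exists>g\<in>Gamma0 (p * m). A = g ** r" if A: "A \<in> Gamma0 m" "int p dvd A$2$2" for A :: "int^2^2"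
    proof
      obtain a b c d where Am: "A = mat2 a b c d" by (rule mat2_cases)
      have abcd: "a * d - b * c = 1" "int m dvd c" "int p dvd d" using A by (auto simp: Am)
      have "int (p * m) dvd c * int p - d * int m"
        using abcd(2,3) by (simp add: mult.commute)
      thus "A ** adj2 r \<in> Gamma0 (p * m)"
        using SL2Z_mult[OF Gamma0_subset_SL2Z[OF A(1)] adj2_SL2Z(1)[OF r]]
        by (simp add: Gamma0_def Am r_def del: mat2_in_SL2Z)
      show "A = A ** adj2 r ** r"
        using adj2_SL2Z(3)[OF r] by (simp add: matrix_mul_assoc[symmetric])
    qed
    moreover have c: "card (insert r T) \<le> p + 1" using T card_insert_le_m1[of "p+1" T r] by auto
    ultimately have "\<exists>g\<in>Gamma0 (p * m). \<exists>s\<in>insert r T. A = g ** s" if "A \<in> Gamma0 m" for A :: "int^2^2"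
      using main[OF \<open>A \<in> Gamma0 m\<close>] \<open>A \<in> Gamma0 m\<close> by blast
    thus thesis using that[of "insert r T"] T r c False by simp
  qed
qed

lemma covers_cosets_step:
  assumes "covers_cosets m R" "prime p" "m > 0"
  obtains R' where "covers_cosets (p * m) R'" "card R' \<le> (if p dvd m then p else p + 1) * card R"
proof -
  obtain S where S: "finite S" "S \<subseteq> SL2Z" "card S \<le> (if p dvd m then p else p + 1)"
    "\<And>A. A \<in> Gamma0 m \<Longrightarrow> \<exists>g\<in>Gamma0 (p * m). \<exists>s\<in>S. A = g ** s"
    using Gamma0_step[OF assms(2,3)] by metis
  define R' where "R' = (\<lambda>(s, r). s ** r) ` (S \<times> R)"
  have R: "finite R" "R \<subseteq> SL2Z" "\<And>A. A \<in> SL2Z \<Longrightarrow> \<exists>g\<in>Gamma0 m. \<exists>r\<in>R. A = g ** r"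
    using assms(1) by (auto simp: covers_cosets_def)
  have "\<exists>g\<in>Gamma0 (p * m). \<exists>r\<in>R'. A = g ** r" if "A \<in> SL2Z" for A
  proof -
    obtain g r where gr: "g \<in> Gamma0 m" "r \<in> R" "A = g ** r" using R(3)[OF \<open>A \<in> SL2Z\<close>] by blast
    obtain g' s where gs: "g' \<in> Gamma0 (p * m)" "s \<in> S" "g = g' ** s" using S(4)[OF gr(1)] by blast
    have "A = g' ** (s ** r)" by (simp add: gr gs matrix_mul_assoc)
    thus ?thesis using gr gs by (auto simp: R'_def)
  qed
  moreover have "finite R'" "R' \<subseteq> SL2Z"
    using S(1,2) R(1,2) SL2Z_mult by (auto simp: R'_def)
  ultimately have "covers_cosets (p * m) R'" by (simp add: covers_cosets_def)
  moreover have "card R' \<le> card S * card R"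
    unfolding R'_def using card_image_le[of "S \<times> R"] S(1) R(1) by (simp add: card_cartesian_product)
  hence "card R' \<le> (if p dvd m then p else p + 1) * card R"
    using S(3) by (meson mult_le_mono1 order_trans)
  ultimately show thesis using that by blast
qed

text \<open>Adding one prime at a time gives the classical value \<open>N \<Prod> (1 + 1/p)\<close> of the index as an upper bound.\<close>

lemma covers_cosets_exists:
  assumes "N > 0"
  shows "\<exists>R. covers_cosets N R \<and> real (card R) \<le> real N * (\<Prod>p\<in>prime_factors N. 1 + 1 / real p)"
  using assms
proof (induction N rule: prime_divisors_induct)
  case (unit N)
  have "covers_cosets 1 {mat 1}"
    unfolding covers_cosets_def by (simp add: SL2Z_def)
  thus ?case using unit by (intro exI[of _ "{mat 1}"]) simp
next
  case (factor p m)
  hence m: "m > 0" by auto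
  with factor obtain R where R: "covers_cosets m R" "real (card R) \<le> real m * (\<Prod>p\<in>prime_factors m. 1 + 1 / real p)"
    by auto
  obtain R' where R': "covers_cosets (p * m) R'" "card R' \<le> (if p dvd m then p else p + 1) * card R"
    using covers_cosets_step[OF R(1) \<open>prime p\<close> m] by blast
  have p0: "real p > 0" using prime_gt_0_nat[OF \<open>prime p\<close>] by simp
  have pf: "prime_factors (p * m) = insert p (prime_factors m)"
    using \<open>prime p\<close> m by (simp add: prime_factors_product prime_prime_factors)
  have "real (card R') \<le> real ((if p dvd m then p else p + 1)) * real (card R)"
    using R'(2) by (metis of_nat_le_iff of_nat_mult)
  also have "\<dots> \<le> real ((if p dvd m then p else p + 1)) * (real m * (\<Prod>p\<in>prime_factors m. 1 + 1 / real p))"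
    by (intro mult_left_mono R(2)) auto
  also have "\<dots> = real (p * m) * (\<Prod>p\<in>prime_factors (p * m). 1 + 1 / real p)"
  proof (cases "p dvd m")
    case True
    hence "p \<in> prime_factors m" using \<open>prime p\<close> m by (simp add: prime_factors_dvd)
    thus ?thesis using True unfolding pf by (simp add: insert_absorb)
  next
    case False
    hence "p \<notin> prime_factors m" by auto
    thus ?thesis using False p0 unfolding pf by (simp add: field_simps)
  qed
  finally show ?case using R'(1) by blast
qed auto

text \<open>The largest element of \<open>S\<close> is at least \<open>card S\<close>. Removing it repeatedly compares the product with
  the telescoping product of the factors \<open>(i + 1) / i\<close>.\<close>

lemma prod_one_plus_inverse_le:
  fixes S :: "nat set"
  assumes "finite S" "0 \<notin> S"
  shows "(\<Prod>p\<in>S. 1 + 1 / real p) \<le> real (card S) + 1"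
  using assms
proof (induction "card S" arbitrary: S)
  case (Suc n)
  define q where "q = Max S"
  have q: "q \<in> S" using Suc by (auto simp: q_def card_gt_0_iff intro!: Max_in)
  have "S \<subseteq> {1..q}" using Suc by (auto simp: q_def Suc_le_eq intro!: Nat.gr0I)
  hence "card S \<le> q" using card_mono[of "{1..q}" S] by simp
  hence nq: "Suc n \<le> q" using Suc by simp
  have c: "card (S - {q}) = n" using q Suc by simp
  have "(\<Prod>p\<in>S. 1 + 1 / real p) = (1 + 1 / real q) * (\<Prod>p\<in>S - {q}. 1 + 1 / real p)"
    using q Suc by (simp add: prod.remove)
  also have "\<dots> \<le> (1 + 1 / real (Suc n)) * (real n + 1)"
  proof (intro mult_mono)
    show "(\<Prod>p\<in>S - {q}. 1 + 1 / real p) \<le> real n + 1"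
      using Suc.hyps(1)[of "S - {q}"] c Suc by auto
    show "1 + 1 / real q \<le> 1 + 1 / real (Suc n)" using nq by (intro add_mono divide_left_mono) auto
  qed (auto intro!: prod_nonneg)
  also have "\<dots> = real (Suc n) + 1" by (simp add: field_simps)
  finally show ?case using Suc by simp
qed auto

lemma two_power_card_prime_factors_le:
  assumes "N > (0::nat)"
  shows "2 ^ card (prime_factors N) \<le> N"
proof -
  have "2 ^ card (prime_factors N) \<le> (\<Prod>p\<in>prime_factors N. p)"
    unfolding prod_constant[symmetric]
    by (intro prod_mono) (auto simp: prime_ge_2_nat in_prime_factors_iff)
  also have "(\<Prod>p\<in>prime_factors N. p) \<le> (\<Prod>p\<in>prime_factors N. p ^ multiplicity p N)"
    using assms by (intro prod_mono) (auto simp: in_prime_factors_iff prime_multiplicity_gt_zero_iff prime_gt_0_nat Suc_le_eq intro!: self_le_power)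
  also have "\<dots> = N" using prime_factorization_nat[of N] assms by simp
  finally show ?thesis .
qed

lemma covers_cosets_card_le:
  assumes "N > 0"
  obtains R where "covers_cosets N R" "real (card R) \<le> real N * (2 * ln (real N) + 1)"
proof -
  obtain R where R: "covers_cosets N R" "real (card R) \<le> real N * (\<Prod>p\<in>prime_factors N. 1 + 1 / real p)"
    using covers_cosets_exists[OF assms] by blast
  have "real (2 ^ card (prime_factors N)) \<le> real N"
    using two_power_card_prime_factors_le[OF assms] by (simp only: of_nat_le_iff)
  hence "ln (2 ^ card (prime_factors N)) \<le> ln (real N)" using assms by simp
  hence "real (card (prime_factors N)) * ln 2 \<le> ln (real N)" by (simp add: ln_realpow)
  moreover have "real (card (prime_factors N)) * (1/2) \<le> real (card (prime_factors N)) * ln 2"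
    using ln2_ge_two_thirds by (intro mult_left_mono) auto
  ultimately have "real (card (prime_factors N)) \<le> 2 * ln (real N)" by linarith
  moreover have "(\<Prod>p\<in>prime_factors N. 1 + 1 / real p) \<le> real (card (prime_factors N)) + 1"
    by (rule prod_one_plus_inverse_le) (auto simp: in_prime_factors_iff)
  ultimately have "(\<Prod>p\<in>prime_factors N. 1 + 1 / real p) \<le> 2 * ln (real N) + 1" by linarith
  hence "real N * (\<Prod>p\<in>prime_factors N. 1 + 1 / real p) \<le> real N * (2 * ln (real N) + 1)"
    by (intro mult_left_mono) auto
  thus thesis using R that by (meson order_trans)
qed


section \<open>Siegel's bound on the order of vanishing\<close>

text \<open>The constant is not optimal, \<open>\<surd>3/2\<close> being the true one. With \<open>Q\<close> close to \<open>(Im z)\<^bsup>-1/2\<^esup>\<close>, Dirichlet's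
  approximation theorem yields coprime \<open>c \<le> Q\<close> and \<open>h\<close> with \<open>|c Re z - h| < 1/Q\<close>, and for a matrix with bottom row
  \<open>(c, -h)\<close> both parts of \<open>c z - h\<close> are of order \<open>(Im z)\<^bsup>1/2\<^esup>\<close>.\<close>

lemma exists_SL2Z_Im_ge:
  assumes z: "Im z > 0"
  obtains B where "B \<in> SL2Z" "Im (moebius_action B z) \<ge> 1/5"
proof (cases "Im z \<ge> 1/5")
  case True
  thus thesis using that[of "mat 1"] by (simp add: mat1_eq_mat2 moebius_action_def automorphy_factor_def)
next
  case False
  define y where "y = Im z"
  have y: "0 < y" "y < 1/5" using z False by (auto simp: y_def)
  define Q where "Q = nat \<lfloor>1 / sqrt y\<rfloor>"
  have sy: "sqrt y < 1/2" using y by (intro real_less_lsqrt) (auto simp: power2_eq_square)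
  have syp: "sqrt y > 0" using y by simp
  have "1 / sqrt y > 2" using sy syp by (simp add: field_simps)
  hence Q: "real Q \<le> 1 / sqrt y" "real Q > 1 / sqrt y - 1" "Q > 0" unfolding Q_def by linarith+
  have Q2: "real Q \<ge> 1 / (2 * sqrt y)" using Q(2) \<open>1 / sqrt y > 2\<close> by (simp add: field_simps)
  obtain h c where hc: "coprime h c" "0 < c" "c \<le> int Q" "\<bar>of_int c * Re z - of_int h\<bar> < 1 / Q"
    using Dirichlet_approx_coprime[OF Q(3), of "Re z"] by metis
  obtain u v where uv: "u * h + v * c = 1" using bezout_int[of h c] hc(1) by auto
  define B where "B = mat2 (-u) (-v) c (-h)"
  have B: "B \<in> SL2Z" using uv by (simp add: B_def algebra_simps)
  have n: "norm (automorphy_factor B z) ^ 2 = (of_int c * Re z - of_int h)^2 + (of_int c * y)^2"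
    by (simp add: automorphy_factor_def B_def cmod_power2 y_def)
  have "(of_int c * Re z - of_int h)^2 \<le> (1 / real Q)^2"
    using hc(4) by (intro power2_le_iff_abs_le[THEN iffD2]) auto
  also have "\<dots> \<le> (2 * sqrt y)^2"
    using Q2 syp Q(3) by (intro power_mono) (auto simp: field_simps)
  also have "\<dots> = 4 * y" using y by (simp add: power_mult_distrib)
  finally have 1: "(of_int c * Re z - of_int h)^2 \<le> 4 * y" .
  have "of_int c \<le> 1 / sqrt y" using hc(3) Q(1) by linarith
  hence "of_int c * y \<le> (1 / sqrt y) * y" using y by (intro mult_right_mono) auto
  also have "\<dots> = sqrt y" using y by (simp add: real_div_sqrt)
  finally have "(of_int c * y)^2 \<le> (sqrt y)^2" using hc(2) y by (intro power_mono) auto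
  hence 2: "(of_int c * y)^2 \<le> y" using y by simp
  have "norm (automorphy_factor B z) ^ 2 \<le> 5 * y" using n 1 2 by simp
  moreover have "norm (automorphy_factor B z) ^ 2 > 0"
    using Im_automorphy_nz[of B z] det_SL2Z[OF B] z by simp
  ultimately have "1/5 \<le> y / norm (automorphy_factor B z) ^ 2" by (simp add: field_simps)
  thus thesis using that[OF B] Im_moebius[of B z] det_SL2Z[OF B] z by (simp add: y_def)
qed

lemma prod_holomorphic_eq_zeroD:
  assumes "finite U" "open S" "connected S" "S \<noteq> {}"
    and "\<And>u. u \<in> U \<Longrightarrow> u holomorphic_on S"
    and "\<And>z. z \<in> S \<Longrightarrow> (\<Prod>u\<in>U. u z) = (0 :: complex)"
  shows "\<exists>u\<in>U. \<forall>z\<in>S. u z = 0"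
  using assms(1,5,6)
proof (induction U rule: finite_induct)
  case empty
  thus ?case using \<open>S \<noteq> {}\<close> by auto
next
  case (insert v U)
  show ?case
  proof (cases "\<forall>z\<in>S. v z = 0")
    case False
    then obtain z0 where z0: "z0 \<in> S" "v z0 \<noteq> 0" by auto
    define V where "V = S \<inter> v -` (- {0})"
    have "continuous_on S v" using insert.prems(1) by (auto intro: holomorphic_on_imp_continuous_on)
    hence "open V" unfolding V_def using \<open>open S\<close> by (intro continuous_open_preimage) auto
    have "(\<Prod>u\<in>U. u z) = 0" if "z \<in> S" for z
    proof (rule analytic_continuation_open[of V S "\<lambda>z. \<Prod>u\<in>U. u z" "\<lambda>_. 0"])
      show "(\<lambda>z. \<Prod>u\<in>U. u z) holomorphic_on S"
        using insert.prems(1) by (intro holomorphic_on_prod) auto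
      show "(\<Prod>u\<in>U. u w) = 0" if "w \<in> V" for w
        using insert.prems(2)[of w] that insert.hyps by (auto simp: V_def)
    qed (use \<open>open V\<close> \<open>open S\<close> \<open>connected S\<close> z0 that in \<open>auto simp: V_def\<close>)
    thus ?thesis using insert.IH insert.prems(1) by auto
  qed auto
qed

lemma open_H: "open \<H>" and connected_H: "connected \<H>"
  unfolding upper_half_plane_def
  by (rule open_halfspace_Im_gt, intro convex_connected convex_halfspace_Im_gt)

lemma holomorphic_modular_form: "f \<in> modular_forms k N \<Longrightarrow> f holomorphic_on \<H>"
  and modular_form_off_H: "f \<in> modular_forms k N \<Longrightarrow> Im z \<le> 0 \<Longrightarrow> f z = 0"
  and modular_form_invariant:
    "f \<in> modular_forms k N \<Longrightarrow> A \<in> Gamma0 N \<Longrightarrow> Im z > 0 \<Longrightarrow> slash k f A z = f z"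
  and modular_form_expansion:
    "f \<in> modular_forms k N \<Longrightarrow> A \<in> SL2Z \<Longrightarrow> \<exists>a. has_fourier_expansion N (slash k f A) a"
  by (auto simp: modular_forms_def)

text \<open>Outside the half-plane a slashed form takes meaningless values. Cutting it off there makes
  equality of conjugates an equality of functions, so that they form a finite set.\<close>

definition slash_H :: "nat \<Rightarrow> form \<Rightarrow> int^2^2 \<Rightarrow> form" where
  "slash_H k f A = (\<lambda>z. if Im z > 0 then slash k f A z else 0)"

lemma slash_H_slash_H:
  assumes "det A > 0" "det B > 0"
  shows "slash_H k (slash_H k f A) B = slash_H k f (A ** B)"
proof
  fix z
  show "slash_H k (slash_H k f A) B z = slash_H k f (A ** B) z"
  proof (cases "Im z > 0")
    case True
    have "slash k (slash_H k f A) B z = slash k (slash k f A) B z"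
      by (rule slash_cong) (use assms True in \<open>auto simp: slash_H_def\<close>)
    thus ?thesis using True slash_slash[OF assms True] by (simp add: slash_H_def)
  qed (simp add: slash_H_def)
qed

definition conjugates :: "nat \<Rightarrow> form \<Rightarrow> form set" where
  "conjugates k f = slash_H k f ` SL2Z"

lemma slash_H_conjugates:
  assumes "B \<in> SL2Z"
  shows "bij_betw (\<lambda>u. slash_H k u B) (conjugates k f) (conjugates k f)"
proof (rule bij_betw_byWitness[where f' = "\<lambda>u. slash_H k u (adj2 B)"])
  have B: "det B = 1" "det (adj2 B) = 1" "adj2 B \<in> SL2Z"
    using assms adj2_SL2Z(1)[OF assms] det_SL2Z by auto
  have c: "slash_H k (slash_H k f A) B = slash_H k f (A ** B)"
       "slash_H k (slash_H k f A) (adj2 B) = slash_H k f (A ** adj2 B)" if "A \<in> SL2Z" for A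
    using that B by (auto simp: slash_H_slash_H det_SL2Z)
  have d: "slash_H k (slash_H k f (A ** B)) (adj2 B) = slash_H k f A"
          "slash_H k (slash_H k f (A ** adj2 B)) B = slash_H k f A" if "A \<in> SL2Z" for A
    using that B SL2Z_mult[OF that assms] SL2Z_mult[OF that B(3)] adj2_SL2Z(2,3)[OF assms]
    by (simp_all add: slash_H_slash_H det_SL2Z matrix_mul_assoc[symmetric])
  show "\<forall>u\<in>conjugates k f. slash_H k (slash_H k u B) (adj2 B) = u"
       "\<forall>u\<in>conjugates k f. slash_H k (slash_H k u (adj2 B)) B = u"
    by (auto simp: conjugates_def c d)
  show "(\<lambda>u. slash_H k u B) ` conjugates k f \<subseteq> conjugates k f"
       "(\<lambda>u. slash_H k u (adj2 B)) ` conjugates k f \<subseteq> conjugates k f"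
    using SL2Z_mult assms B(3) by (auto simp: conjugates_def c)
qed

text \<open>A conjugate depends only on the coset \<open>\<Gamma>\<^sub>0(M) A\<close>.\<close>

lemma conjugates_finite:
  assumes "f \<in> modular_forms k M" "covers_cosets M R"
  shows "finite (conjugates k f)" "card (conjugates k f) \<le> card R"
proof -
  have R: "finite R" "R \<subseteq> SL2Z" "\<And>A. A \<in> SL2Z \<Longrightarrow> \<exists>g\<in>Gamma0 M. \<exists>r\<in>R. A = g ** r"
    using assms(2) by (auto simp: covers_cosets_def)
  have "conjugates k f \<subseteq> slash_H k f ` R"
  proof
    fix u assume "u \<in> conjugates k f"
    then obtain A where A: "A \<in> SL2Z" "u = slash_H k f A" by (auto simp: conjugates_def)
    obtain g r where gr: "g \<in> Gamma0 M" "r \<in> R" "A = g ** r" using R(3)[OF A(1)] by blast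
    have "slash k f A z = slash k f r z" if z: "Im z > 0" for z
    proof -
      have d: "det g > 0" "det r > 0" using gr R(2) det_Gamma0 det_SL2Z by fastforce+
      have "slash k f A z = slash k (slash k f g) r z" using slash_slash[OF d z] gr by simp
      also have "\<dots> = slash k f r z"
        by (rule slash_cong[OF _ d(2) z]) (rule modular_form_invariant[OF assms(1) gr(1)])
      finally show ?thesis .
    qed
    hence "u = slash_H k f r" by (auto simp: A slash_H_def)
    thus "u \<in> slash_H k f ` R" using gr by blast
  qed
  thus "finite (conjugates k f)" "card (conjugates k f) \<le> card R"
    using R(1) card_mono[of "slash_H k f ` R" "conjugates k f"] card_image_le[of R "slash_H k f"]
    by (auto intro: finite_subset)
qed

lemma self_in_conjugates: "f \<in> modular_forms k M \<Longrightarrow> f \<in> conjugates k f"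
  unfolding conjugates_def
  by (rule image_eqI[of _ _ "mat 1"]) 
     (auto simp: slash_H_def fun_eq_iff modular_form_off_H SL2Z_def)

text \<open>With \<open>t = 10 y\<close> the left-hand side is \<open>t exp (-(2\<pi>/5)(t - 1))\<close>, where \<open>2\<pi>/5 > 5/4\<close>, \<open>t \<le> exp (t - 1)\<close> and \<open>t \<ge> 2\<close>.\<close>

lemma norm_exp_estimate:
  fixes y :: real
  assumes "y \<ge> 1/5"
  shows "10 * y * exp (- 4 * pi * (y - 1/10)) \<le> exp (-1/4)"
proof -
  define t where "t = 10 * y"
  have t: "t \<ge> 2" using assms by (simp add: t_def)
  have "pi > 25/8" using pi_approx(1) by simp
  hence "(2/5) * pi * (t - 1) \<ge> (5/4) * (t - 1)" using t by (intro mult_right_mono) auto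
  moreover have "4 * pi * (y - 1/10) = (2/5) * pi * (t - 1)" by (simp add: t_def algebra_simps)
  ultimately have "(5/4) * (t - 1) \<le> 4 * pi * (y - 1/10)" by linarith
  moreover have "(t - 1) + 1/4 \<le> (5/4) * (t - 1)" using t by (simp add: field_simps)
  ultimately have "(t - 1) + 1/4 \<le> 4 * pi * (y - 1/10)" by (rule order_trans[rotated])
  hence "- (4 * pi * (y - 1/10)) \<le> - ((t - 1) + 1/4)" by (rule le_imp_neg_le)
  hence "- 4 * pi * (y - 1/10) \<le> - (t - 1) + -1/4" by simp
  hence "exp (- 4 * pi * (y - 1/10)) \<le> exp (- (t - 1)) * exp (-1/4)"
    unfolding exp_add[symmetric] by (simp only: exp_le_cancel_iff)
  hence "t * exp (- 4 * pi * (y - 1/10)) \<le> t * (exp (- (t - 1)) * exp (-1/4))"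
    using t by (intro mult_left_mono) auto
  also have "\<dots> = (t * exp (- (t - 1))) * exp (-1/4)" by simp
  also have "t \<le> exp (t - 1)" using exp_ge_add_one_self[of "t - 1"] by simp
  hence "t * exp (- (t - 1)) \<le> 1" unfolding exp_minus by (simp add: field_simps)
  hence "(t * exp (- (t - 1))) * exp (-1/4) \<le> 1 * exp (-1/4)" by (intro mult_right_mono) auto
  finally show ?thesis by (simp add: t_def)
qed

text \<open>A form of level one and weight \<open>K\<close> that vanishes at infinity to order at least \<open>K\<close> in \<open>exp (2\<pi>iz)\<close> is zero. Its
  invariant \<open>\<Phi>(z) = |F(z)|\<^sup>2 (Im z)\<^sup>K\<close> has a finite supremum \<open>S\<close>, and it suffices to bound \<open>\<Phi>\<close> where \<open>Im z \<ge> 1/5\<close>. The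
  value \<open>S\<close> bounds \<open>F\<close>, and so \<open>G\<close>, on the line \<open>Im z = 1/10\<close>; by the maximum principle the bound for \<open>G\<close> holds above
  this line, and the factor \<open>q\<^sup>L\<close> gained in going from height \<open>1/10\<close> to height \<open>1/5\<close> outweighs the loss from \<open>(Im z)\<^sup>K\<close>.\<close>

lemma norm_form_eq_zero:
  fixes F :: "complex \<Rightarrow> complex" and L M K :: nat
  assumes M: "M > 0" and K: "K > 0" and L: "L \<ge> M * K"
    and weight: "\<And>B z. B \<in> SL2Z \<Longrightarrow> Im z > 0 \<Longrightarrow>
            F (moebius_action B z) = automorphy_factor B z ^ K * F z"
    and F: "\<And>z. Im z > 0 \<Longrightarrow> F z = qpar M z ^ L * G (qpar M z)"
    and G: "G holomorphic_on ball 0 1"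
    and z: "Im z > 0"
  shows "F z = 0"
proof -
  define \<Phi> where "\<Phi> = (\<lambda>z. norm (F z) ^ 2 * Im z ^ K)"
  have inv: "\<Phi> (moebius_action B z) = \<Phi> z" if "B \<in> SL2Z" "Im z > 0" for B z
  proof -
    have "automorphy_factor B z \<noteq> 0"
      using Im_automorphy_nz[of B z] that by (simp add: det_SL2Z)
    thus ?thesis
      using that Im_moebius[of B z] weight[OF that] unfolding \<Phi>_def
      by (simp add: det_SL2Z norm_mult norm_power power_mult_distrib power_divide
            power_mult[symmetric] mult.commute)
  qed
  have red: "\<exists>w. Im w \<ge> 1/5 \<and> \<Phi> w = \<Phi> z" if "Im z > 0" for z
    using exists_SL2Z_Im_ge[OF that] inv that by metis
  \<comment> \<open>The circle of radius \<open>r\<close> is the image of the line \<open>Im z = 1/10\<close> under \<open>qpar M\<close>.\<close>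
  define r where "r = exp (- 2 * pi * (1/10) / real M)"
  have r: "0 < r" "r < 1" using M by (simp_all add: r_def)
  have ball: "cball 0 r \<subseteq> ball (0::complex) 1" using r by auto
  have Gcont: "continuous_on (cball 0 r) G"
    using G ball holomorphic_on_imp_continuous_on continuous_on_subset by blast
  have qr: "norm (qpar M z) \<le> r" if "Im z \<ge> 1/5" for z
    unfolding norm_qpar r_def exp_le_cancel_iff using that M
    by (intro divide_right_mono mult_left_mono_neg) auto
  have pow: "norm (qpar M z) ^ L / r ^ L = exp (- 2 * pi * (Im z - 1/10) * (real L / real M))" for z
    unfolding norm_qpar r_def exp_of_nat_mult[symmetric] exp_diff[symmetric]
    using M by (simp add: field_simps)
  have LM: "real L / real M \<ge> real K"
    using L M by (simp add: field_simps) (metis mult.commute of_nat_le_iff of_nat_mult)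
  \<comment> \<open>Used twice: with \<open>T\<close> from the crude bound \<open>C\<close> for \<open>G\<close>, to see that \<open>\<Phi>\<close> is
    bounded, and with \<open>T = S\<close>, to obtain the contraction.\<close>
  have est: "\<Phi> z \<le> exp (-1/4) * T"
    if y: "Im z \<ge> 1/5" and T: "norm (G (qpar M z)) ^ 2 * (r ^ L) ^ 2 \<le> T * 10 ^ K" "T \<ge> 0" for z T
  proof -
    have "\<Phi> z = (norm (qpar M z) ^ L / r ^ L) ^ 2 * (norm (G (qpar M z)) ^ 2 * (r ^ L) ^ 2) * Im z ^ K"
      using y r by (simp add: \<Phi>_def F norm_mult norm_power power_divide power_mult_distrib)
    also have "\<dots> \<le> (norm (qpar M z) ^ L / r ^ L) ^ 2 * (T * 10 ^ K) * Im z ^ K"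
      using y by (intro mult_right_mono mult_left_mono T) auto
    also have "(norm (qpar M z) ^ L / r ^ L) ^ 2 = exp (- 4 * pi * (Im z - 1/10) * (real L / real M))"
      unfolding pow exp_double[symmetric] by simp
    also have "\<dots> \<le> exp (- 4 * pi * (Im z - 1/10) * real K)"
      using mult_left_mono[OF LM, of "4 * pi * (Im z - 1/10)"] y by simp
    also have "\<dots> = exp (- 4 * pi * (Im z - 1/10)) ^ K"
      by (simp add: exp_of_nat_mult[symmetric] mult.commute)
    finally have "\<Phi> z \<le> exp (- 4 * pi * (Im z - 1/10)) ^ K * (T * 10 ^ K) * Im z ^ K"
      using y T by (simp add: mult_right_mono)
    also have "\<dots> = (10 * Im z * exp (- 4 * pi * (Im z - 1/10))) ^ K * T"
      by (simp add: power_mult_distrib)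
    also have "\<dots> \<le> exp (-1/4) ^ K * T"
      using norm_exp_estimate[OF y] y T by (intro mult_right_mono power_mono) auto
    also have "\<dots> \<le> exp (-1/4) ^ 1 * T"
      using K T by (intro mult_right_mono power_decreasing) auto
    finally show ?thesis by simp
  qed
  have "compact (G ` cball 0 r)" by (intro compact_continuous_image Gcont) auto
  then obtain C where "\<forall>x\<in>G ` cball 0 r. norm x \<le> C"
    using compact_imp_bounded[of "G ` cball 0 r"] unfolding bounded_iff by blast
  hence C: "norm (G w) \<le> C" if "norm w \<le> r" for w using that by simp
  have C0: "C \<ge> 0" using order_trans[OF norm_ge_zero C[of 0]] r by simp
  have bdd: "\<Phi> z \<le> C ^ 2" if z: "Im z > 0" for z
  proof -
    obtain w where w: "Im w \<ge> 1/5" "\<Phi> w = \<Phi> z" using red[OF z] by blast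
    have "norm (G (qpar M w)) ^ 2 * (r ^ L) ^ 2 \<le> C ^ 2 * 1"
      using C[OF qr[OF w(1)]] r C0 by (intro mult_mono power_mono power_le_one) auto
    also have "\<dots> \<le> C ^ 2 * 10 ^ K" by (intro mult_left_mono) auto
    finally have "\<Phi> w \<le> exp (-1/4) * C ^ 2" using est[OF w(1)] by simp
    also have "\<dots> \<le> 1 * C ^ 2" by (intro mult_right_mono) auto
    finally show ?thesis using w by simp
  qed
  define S where "S = (SUP z\<in>\<H>. \<Phi> z)"
  have bdd': "bdd_above (\<Phi> ` \<H>)" using bdd by (intro bdd_aboveI[of _ "C^2"]) auto
  have le_S: "\<Phi> z \<le> S" if "Im z > 0" for z
    unfolding S_def using bdd' that by (intro cSUP_upper) auto
  have S0: "S \<ge> 0" using le_S[of \<i>] by (rule order_trans[rotated]) (simp_all add: \<Phi>_def)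
  have circle: "norm (G w) \<le> sqrt (S * 10 ^ K) / r ^ L" if w: "norm w = r" for w
  proof -
    obtain v where v: "Im v > 0" "qpar M v = w" by (rule qpar_surj[of w M]) (use w r M in auto)
    have Imv: "Im v = 1/10" using norm_qpar[of M v] v w M by (simp add: r_def field_simps)
    have "\<Phi> v = (norm (G w) * r ^ L) ^ 2 * (1/10) ^ K"
      unfolding \<Phi>_def F[OF v(1)] v(2) Imv by (simp add: norm_mult norm_power w mult.commute)
    hence "(norm (G w) * r ^ L) ^ 2 * (1/10) ^ K \<le> S" using le_S[OF v(1)] by simp
    hence "(norm (G w) * r ^ L) ^ 2 \<le> S * 10 ^ K" by (simp add: field_simps)
    hence "norm (G w) * r ^ L \<le> sqrt (S * 10 ^ K)" by (rule real_le_rsqrt)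
    thus ?thesis using r by (simp add: field_simps)
  qed
  have disc: "norm (G w) \<le> sqrt (S * 10 ^ K) / r ^ L" if w: "norm w \<le> r" for w
  proof (rule maximum_modulus_frontier[of G "cball 0 r"])
    show "G holomorphic_on interior (cball 0 r)"
      using G ball interior_subset holomorphic_on_subset by (metis order_trans)
    show "norm (G v) \<le> sqrt (S * 10 ^ K) / r ^ L" if "v \<in> frontier (cball 0 r)" for v
      using circle[of v] that r by simp
  qed (use w Gcont in auto)
  have S_le: "\<Phi> z \<le> exp (-1/4) * S" if z: "Im z > 0" for z
  proof -
    obtain w where w: "Im w \<ge> 1/5" "\<Phi> w = \<Phi> z" using red[OF z] by blast
    have "norm (G (qpar M w)) * r ^ L \<le> sqrt (S * 10 ^ K)"
      using disc[OF qr[OF w(1)]] r by (simp add: field_simps)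
    hence "(norm (G (qpar M w)) * r ^ L) ^ 2 \<le> sqrt (S * 10 ^ K) ^ 2"
      using r by (intro power_mono) auto
    hence "norm (G (qpar M w)) ^ 2 * (r ^ L) ^ 2 \<le> S * 10 ^ K"
      using S0 by (simp add: power_mult_distrib)
    from est[OF w(1) this S0] w show ?thesis by simp
  qed
  have "\<i> \<in> \<H>" by simp
  hence "\<H> \<noteq> {}" by blast
  hence "(SUP z\<in>\<H>. \<Phi> z) \<le> exp (-1/4) * S" by (rule cSUP_least) (use S_le in auto)
  hence S_contract: "S \<le> exp (-1/4) * S" by (simp only: S_def)
  have "S \<le> 0"
  proof (rule ccontr)
    assume "\<not> S \<le> 0"
    hence "exp (-1/4) * S < 1 * S" by (intro mult_strict_right_mono) auto
    thus False using S_contract by simp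
  qed
  hence "\<Phi> z \<le> 0" using le_S[OF z] by simp
  moreover have "Im z ^ K > 0" using z by simp
  ultimately have "norm (F z) ^ 2 \<le> 0" unfolding \<Phi>_def by (simp add: mult_le_0_iff)
  thus "F z = 0" by simp
qed

text \<open>The product of the conjugates of \<open>h\<close> is a form of level one. It is \<open>q\<^sup>L\<close> times a power series in \<open>q = exp (2\<pi>iz/M)\<close>:
  the factor \<open>h\<close> supplies \<open>q\<^sup>L\<close> and the other conjugates are holomorphic at their cusps. Hence the product is zero, so one
  conjugate is, and then so is \<open>h\<close>.\<close>

theorem sturm_bound:
  assumes h: "h \<in> modular_forms k M" and M: "M > 0" and k: "k > 0" and R: "covers_cosets M R"
    and a: "has_fourier_expansion M h a" "\<And>j. j < L \<Longrightarrow> a j = 0" and L: "L \<ge> M * k * card R"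
  shows "h z = 0"
proof (cases "Im z > 0")
  case z: True
  define U where "U = conjugates k h"
  have fin: "finite U" "card U \<le> card R" using conjugates_finite[OF h R] by (auto simp: U_def)
  have hU: "h \<in> U" using self_in_conjugates[OF h] by (simp add: U_def)
  have cU: "card U > 0" using fin hU by (auto simp: card_gt_0_iff)
  have holU: "u holomorphic_on \<H>" if u: "u \<in> U" for u
  proof -
    obtain A where A: "A \<in> SL2Z" "u = slash_H k h A" using u by (auto simp: U_def conjugates_def)
    have "slash k h A holomorphic_on \<H>"
      using holomorphic_slash holomorphic_modular_form[OF h] det_SL2Z[OF A(1)] by simp
    thus ?thesis by (rule holomorphic_transform) (simp add: A slash_H_def)
  qed
  have expU: "\<exists>g. g holomorphic_on ball 0 1 \<and> (\<forall>z. Im z > 0 \<longrightarrow> u z = g (qpar M z))" if u: "u \<in> U" for u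
  proof -
    obtain A where A: "A \<in> SL2Z" "u = slash_H k h A" using u by (auto simp: U_def conjugates_def)
    obtain b where "has_fourier_expansion M (slash k h A) b"
      using modular_form_expansion[OF h A(1)] by blast
    hence "has_fourier_expansion M u b"
      by (rule fourier_expansion_cong) (simp add: A slash_H_def)
    then obtain g where "g holomorphic_on ball 0 1" "\<And>z. Im z > 0 \<Longrightarrow> u z = g (qpar M z)"
      using M by (rule fourier_expansion_disc) blast
    thus ?thesis by blast
  qed
  hence "\<exists>g. \<forall>u\<in>U. g u holomorphic_on ball 0 1 \<and> (\<forall>z. Im z > 0 \<longrightarrow> u z = g u (qpar M z))"
    by (intro bchoice) blast
  then obtain g where g: "\<And>u. u \<in> U \<Longrightarrow> g u holomorphic_on ball 0 1"
    "\<And>u z. u \<in> U \<Longrightarrow> Im z > 0 \<Longrightarrow> u z = g u (qpar M z)" by blast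
  have "has_fourier_expansion M (\<lambda>z. h z / qpar M z ^ L) (\<lambda>n. a (n + L))"
    unfolding has_fourier_expansion_qpar
  proof (intro allI impI)
    fix z :: complex assume z: "Im z > 0"
    have nz: "qpar M z \<noteq> 0" by (simp add: qpar_def)
    have "(\<lambda>n. a n * qpar M z ^ n) sums h z" using a(1) z by (simp add: has_fourier_expansion_qpar)
    moreover have "(\<Sum>n<L. a n * qpar M z ^ n) = 0" using a(2) by simp
    ultimately have "(\<lambda>n. a (n + L) * qpar M z ^ (n + L)) sums h z"
      using sums_iff_shift[of "\<lambda>n. a n * qpar M z ^ n" L "h z"] by simp
    hence "(\<lambda>n. a (n + L) * qpar M z ^ (n + L) / qpar M z ^ L) sums (h z / qpar M z ^ L)"
      by (rule sums_divide)
    thus "(\<lambda>n. a (n + L) * qpar M z ^ n) sums (h z / qpar M z ^ L)"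
      using nz by (simp add: power_add)
  qed
  then obtain g0 where g0: "g0 holomorphic_on ball 0 1"
    "\<And>z. Im z > 0 \<Longrightarrow> h z / qpar M z ^ L = g0 (qpar M z)"
    using M by (rule fourier_expansion_disc) blast
  have "(\<Prod>u\<in>U. u z) = 0" if z: "Im z > 0" for z
  proof (rule norm_form_eq_zero[of M "k * card U" L "\<lambda>z. \<Prod>u\<in>U. u z" "\<lambda>w. g0 w * (\<Prod>u\<in>U - {h}. g u w)"])
    show "M * (k * card U) \<le> L"
      using le_trans[OF mult_le_mono2[OF fin(2)] L] by (simp only: mult.assoc)
    show "(\<lambda>w. g0 w * (\<Prod>u\<in>U - {h}. g u w)) holomorphic_on ball 0 1"
      using g(1) g0(1) by (intro holomorphic_on_mult holomorphic_on_prod) auto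
    show "(\<Prod>u\<in>U. u z) = qpar M z ^ L * (g0 (qpar M z) * (\<Prod>u\<in>U - {h}. g u (qpar M z)))"
      if z: "Im z > 0" for z
    proof -
      have "h z = qpar M z ^ L * g0 (qpar M z)"
        using g0(2)[OF z] by (simp add: qpar_def field_simps)
      moreover have "(\<Prod>u\<in>U - {h}. u z) = (\<Prod>u\<in>U - {h}. g u (qpar M z))"
        using g(2) z by (intro prod.cong) auto
      ultimately show ?thesis using prod.remove[OF fin(1) hU, of "\<lambda>u. u z"] by simp
    qed
    show "(\<Prod>u\<in>U. u (moebius_action B z)) = automorphy_factor B z ^ (k * card U) * (\<Prod>u\<in>U. u z)"
      if B: "B \<in> SL2Z" and z: "Im z > 0" for B z
    proof -
      have nz: "automorphy_factor B z \<noteq> 0" using Im_automorphy_nz[of B z] B z by (simp add: det_SL2Z)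
      have "(\<Prod>u\<in>U. u (moebius_action B z)) = (\<Prod>u\<in>U. slash_H k u B z * automorphy_factor B z ^ k)"
        using nz z by (simp add: slash_H_def slash_def)
      also have "\<dots> = (\<Prod>u\<in>U. slash_H k u B z) * automorphy_factor B z ^ (k * card U)"
        by (simp add: prod.distrib power_mult)
      also have "(\<Prod>u\<in>U. slash_H k u B z) = (\<Prod>u\<in>U. u z)"
        using prod.reindex_bij_betw[OF slash_H_conjugates[OF B, of k h], of "\<lambda>u. u z"]
        by (simp add: U_def)
      finally show ?thesis by simp
    qed
  qed (use M k cU z in auto)
  hence "\<exists>u\<in>U. \<forall>z\<in>\<H>. u z = 0"
    using z by (intro prod_holomorphic_eq_zeroD[OF fin(1) open_H connected_H _ holU])
               (auto simp del: prod_zero_iff)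
  then obtain A where A: "A \<in> SL2Z" "\<And>z. Im z > 0 \<Longrightarrow> slash k h A z = 0"
    by (auto simp: U_def conjugates_def slash_H_def)
  have A': "det A > 0" "det (adj2 A) > 0"
    using det_SL2Z[OF A(1)] det_SL2Z[OF adj2_SL2Z(1)[OF A(1)]] by auto
  have "h z = slash k (slash k h A) (adj2 A) z"
    using slash_slash[OF A' z] adj2_SL2Z(2)[OF A(1)] by simp
  also have "\<dots> = 0" using A(2) moebius_in_H[OF A'(2) z] by (simp add: slash_def[of _ _ "adj2 A"])
  finally show ?thesis .
qed (use modular_form_off_H[OF h] in simp)

section \<open>Hecke operators preserve modular forms\<close>

text \<open>The pairs \<open>(a, b)\<close> that index the matrices with rows \<open>(a, b)\<close> and \<open>(0, m div a)\<close> of the \<open>m\<close>-th Hecke operator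
  on \<open>\<Gamma>\<^sub>0(N)\<close>. For \<open>N = 1\<close> they index all Hermite normal forms of determinant \<open>m\<close>.\<close>

definition hecke_index :: "nat \<Rightarrow> nat \<Rightarrow> (nat \<times> nat) set" where
  "hecke_index N m = Sigma {a. a dvd m \<and> coprime a N} (\<lambda>a. {..<m div a})"

definition hecke_rep :: "nat \<Rightarrow> nat \<times> nat \<Rightarrow> int^2^2" where
  "hecke_rep m = (\<lambda>(a, b). mat2 (int a) (int b) 0 (int (m div a)))"

lemma finite_hecke_index: "m > 0 \<Longrightarrow> finite (hecke_index N m)"
  by (auto simp: hecke_index_def)

lemma hecke_index_dvd:
  assumes "p \<in> hecke_index N m" "m > 0"
  shows "fst p dvd m" "fst p > 0" "m div fst p > 0" "fst p * (m div fst p) = m"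
        "coprime (fst p) N" "snd p < m div fst p"
  using assms by (auto simp: hecke_index_def dvd_div_eq_0_iff intro!: Nat.gr0I)

lemma det_hecke_rep:
  assumes "p \<in> hecke_index N m" "m > 0"
  shows "det (hecke_rep m p) = int m"
proof -
  have "int (fst p) * int (m div fst p) = int m"
    using hecke_index_dvd(4)[OF assms] by (metis of_nat_mult)
  thus ?thesis by (cases p) (simp add: hecke_rep_def)
qed

lemma hecke_eq_sum_slash:
  assumes "m > 0"
  shows "hecke k N m f z = of_nat m ^ (k - 1) *
           (\<Sum>p\<in>hecke_index N m. slash k f (hecke_rep m p) z)"
proof -
  have "finite {a. a dvd m \<and> coprime a N}" using assms by auto
  thus ?thesis
    unfolding hecke_def hecke_index_def hecke_rep_def Let_def
    by (subst sum.Sigma) (auto simp: slash_upper case_prod_unfold intro!: sum.cong)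
qed

text \<open>Hermite reduction by \<open>\<Gamma>\<^sub>0(N)\<close>. Let \<open>t\<close> be the gcd of the first column \<open>(a, c)\<close>. A row operation with bottom row
  \<open>(-c/t, a/t)\<close> clears \<open>c\<close>. It lies in \<open>\<Gamma>\<^sub>0(N)\<close>, because \<open>t\<close> divides \<open>a\<close>, which is coprime to \<open>N\<close>, so
  that \<open>N\<close> divides \<open>c/t\<close>. A translation then reduces the upper right entry.\<close>

lemma decompose_upper_triangular:
  fixes D :: "int^2^2"
  assumes det: "det D = int m" and m: "m > 0" and c: "int N dvd D$2$1" and a: "coprime (D$1$1) (int N)"
  obtains g p where "g \<in> Gamma0 N" "p \<in> hecke_index N m" "D = g ** hecke_rep m p"
proof -
  obtain a b c d where D: "D = mat2 a b c d" by (rule mat2_cases)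
  have det': "a * d - b * c = int m" using det by (simp add: D)
  define t where "t = gcd a c"
  have "t \<noteq> 0" using det' m by (auto simp: t_def)
  hence t: "t > 0" by (simp add: t_def order_less_le)
  obtain x y where xy: "x * a + y * c = t" unfolding t_def using bezout_int by metis
  \<comment> \<open>The row operation has rows \<open>(x, y)\<close> and \<open>(-c', a')\<close>.\<close>
  define a' c' where "a' = a div t" and "c' = c div t"
  have ac: "a = t * a'" "c = t * c'" by (simp_all add: a'_def c'_def t_def)
  have "t * (x * a' + y * c') = t * 1" using xy unfolding ac by (simp add: algebra_simps)
  hence xy': "x * a' + y * c' = 1" using t by simp
  have cop: "coprime t (int N)" using assms(4) ac(1) by (simp add: D)
  have "int N dvd t * c'" using c by (simp add: D ac)
  hence Nc': "int N dvd c'" using cop by (meson coprime_commute coprime_dvd_mult_right_iff)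
  define e where "e = a' * d - c' * b"
  have te: "t * e = int m" using det' by (simp add: e_def ac algebra_simps)
  hence e: "e > 0" using t m by (metis of_nat_0_less_iff zero_less_mult_pos)
  define B where "B = x * b + y * d"
  define g where "g = mat2 1 (- (B div e)) 0 1 ** mat2 x y (- c') a'"
  have g: "g \<in> Gamma0 N"
    unfolding g_def using xy' Nc' by (intro Gamma0_mult) (auto simp: algebra_simps)
  have "mat2 x y (- c') a' ** D = mat2 t B 0 e"
    using xy by (simp add: D B_def e_def ac algebra_simps)
  hence gD: "g ** D = mat2 t (B mod e) 0 e"
    unfolding g_def matrix_mul_assoc[symmetric] by (simp add: minus_div_mult_eq_mod[symmetric])
  define p where "p = (nat t, nat (B mod e))"
  have m_eq: "m = nat t * nat e" using te t e by (metis nat_int nat_mult_distrib less_imp_le)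
  have div: "m div nat t = nat e" using t by (simp add: m_eq)
  have "p \<in> hecke_index N m"
  proof -
    have "coprime (nat t) N" using cop t
      by (metis coprime_int_iff int_nat_eq less_imp_le)
    moreover have "nat (B mod e) < nat e" using e by simp
    ultimately show ?thesis using div by (simp add: p_def hecke_index_def) (simp add: m_eq)
  qed
  moreover have "hecke_rep m p = g ** D"
    using t e by (simp add: p_def hecke_rep_def gD div)
  hence "adj2 g ** hecke_rep m p = D"
    using adj2_SL2Z(3)[OF Gamma0_subset_SL2Z[OF g]] by (simp add: matrix_mul_assoc)
  ultimately show thesis using that adj2_Gamma0[OF g] by metis
qed

text \<open>A unimodular matrix relating two upper triangular matrices with positive diagonals is unipotent, and
  a nontrivial translation moves the upper right entry out of its range.\<close>

lemma hecke_rep_unique: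
  assumes "g \<in> Gamma0 N" "p \<in> hecke_index N m" "q \<in> hecke_index N m" "m > 0"
    and eq: "hecke_rep m p = g ** hecke_rep m q"
  shows "p = q"
proof -
  obtain x y r s where g: "g = mat2 x y r s" by (rule mat2_cases)
  obtain a b a' b' where p: "p = (a, b)" "q = (a', b')" by fastforce
  note P = hecke_index_dvd[OF assms(2,4)] and Q = hecke_index_dvd[OF assms(3,4)]
  have e: "int a = x * int a'" "int b = x * int b' + y * int (m div a')"
    "r * int a' = 0" "int (m div a) = r * int b' + s * int (m div a')"
    using eq by (simp_all add: hecke_rep_def p g)
  have "r = 0" using e(3) Q(2) by (simp add: p)
  hence "x * s = 1" using assms(1) by (simp add: g)
  moreover have "x > 0" using e(1) P(2) Q(2) by (simp add: p) (metis of_nat_0_less_iff zero_less_mult_pos2)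
  ultimately have "x = 1" by (metis zmult_eq_1_iff less_int_code(1) neg_0_less_iff_less not_one_less_zero)
  hence aa: "a = a'" using e(1) by simp
  have "int b mod int (m div a') = int b' mod int (m div a')" using e(2) \<open>x = 1\<close> by simp
  hence "b = b'" using P(6) Q(6) by (simp add: p aa)
  with aa show ?thesis by (simp add: p)
qed

lemma modular_form_off_H': "f \<in> modular_forms k N \<Longrightarrow> \<not> Im z > 0 \<Longrightarrow> f z = 0"
  using modular_form_off_H by simp

lemma modular_formI:
  assumes "f holomorphic_on \<H>" "\<And>z. \<not> Im z > 0 \<Longrightarrow> f z = 0"
    "\<And>A z. A \<in> Gamma0 N \<Longrightarrow> Im z > 0 \<Longrightarrow> slash k f A z = f z"
    "\<And>A. A \<in> SL2Z \<Longrightarrow> \<exists>a. has_fourier_expansion N (slash k f A) a"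
  shows "f \<in> modular_forms k N"
  using assms by (auto simp: modular_forms_def)

lemma modular_forms_zero: "(\<lambda>_. 0) \<in> modular_forms k N"
  by (rule modular_formI) (auto simp: slash_def has_fourier_expansion_def intro!: exI[of _ "\<lambda>_. 0"])

lemma modular_forms_scale:
  assumes "f \<in> modular_forms k N"
  shows "(\<lambda>z. c * f z) \<in> modular_forms k N"
proof (rule modular_formI)
  show "\<exists>a. has_fourier_expansion N (slash k (\<lambda>z. c * f z) A) a" if "A \<in> SL2Z" for A
    using modular_form_expansion[OF assms that] fourier_expansion_scale
    unfolding slash_scale[abs_def] by blast
qed (use assms in \<open>auto simp: slash_scale modular_form_invariant modular_form_off_H'
       intro!: holomorphic_intros holomorphic_modular_form[OF assms]\<close>)

lemma modular_forms_add:
  assumes "f \<in> modular_forms k N" "g \<in> modular_forms k N"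
  shows "(\<lambda>z. f z + g z) \<in> modular_forms k N"
proof (rule modular_formI)
  have add: "slash k (\<lambda>z. f z + g z) A = (\<lambda>z. slash k f A z + slash k g A z)" for A
    by (simp add: slash_def add_divide_distrib fun_eq_iff)
  show "\<exists>a. has_fourier_expansion N (slash k (\<lambda>z. f z + g z) A) a" if "A \<in> SL2Z" for A
    using modular_form_expansion[OF assms(1) that] modular_form_expansion[OF assms(2) that]
      fourier_expansion_add unfolding add by blast
  show "slash k (\<lambda>z. f z + g z) A z = f z + g z" if "A \<in> Gamma0 N" "Im z > 0" for A z
    using assms that by (simp add: add modular_form_invariant)
qed (use assms in \<open>auto simp: modular_form_off_H'
       intro!: holomorphic_intros holomorphic_modular_form[OF assms(1)] holomorphic_modular_form[OF assms(2)]\<close>)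

lemma modular_forms_diff:
  assumes "f \<in> modular_forms k N" "g \<in> modular_forms k N"
  shows "(\<lambda>z. f z - g z) \<in> modular_forms k N"
  using modular_forms_add[OF assms(1) modular_forms_scale[OF assms(2), of "-1"]] by simp

text \<open>By Hermite reduction over \<open>SL\<^sub>2(\<int>)\<close>, slashing by \<open>D\<close> is slashing by a unimodular matrix, where the
  expansion is given, followed by an affine substitution.\<close>

lemma expansion_slash_det:
  assumes f: "f \<in> modular_forms k N" and N: "N > 0" and m: "m > 0" and det: "det D = int m"
  shows "\<exists>a. has_fourier_expansion (m * N) (slash k f D) a"
proof -
  obtain g p where g: "g \<in> SL2Z" and p: "p \<in> hecke_index 1 m" and D: "D = g ** hecke_rep m p"
    using decompose_upper_triangular[of D m 1] det m by auto
  obtain a where a: "has_fourier_expansion N (slash k f g) a"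
    using modular_form_expansion[OF f g] by blast
  obtain \<alpha> \<beta> where p_eq: "p = (\<alpha>, \<beta>)" by fastforce
  define \<delta> where "\<delta> = m div \<alpha>"
  have pos: "\<alpha> > 0" "\<delta> > 0" "\<alpha> * \<delta> = m"
    using hecke_index_dvd[OF p m] by (simp_all add: p_eq \<delta>_def)
  let ?b = "\<lambda>n. 1 / of_nat \<delta> ^ k * spread \<alpha> (\<lambda>n. a n * exp (2 * of_real pi * \<i> * of_int (int \<beta>) / of_nat (\<delta> * N)) ^ n) n"
  have "has_fourier_expansion (\<delta> * N) (\<lambda>z. 1 / of_nat \<delta> ^ k * slash k f g ((of_nat \<alpha> * z + of_int (int \<beta>)) / of_nat \<delta>)) ?b"
    by (intro fourier_expansion_scale fourier_expansion_affine[OF a N] pos)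
  hence "has_fourier_expansion (\<alpha> * (\<delta> * N)) (\<lambda>z. 1 / of_nat \<delta> ^ k * slash k f g ((of_nat \<alpha> * z + of_int (int \<beta>)) / of_nat \<delta>)) (spread \<alpha> ?b)"
    by (subst fourier_expansion_rescale[OF pos(1)])
  hence "has_fourier_expansion (m * N) (slash k f D) (spread \<alpha> ?b)"
    unfolding mult.assoc[symmetric] pos(3)
  proof (rule fourier_expansion_cong)
    fix z :: complex assume z: "Im z > 0"
    have "slash k f D z = slash k (slash k f g) (hecke_rep m p) z"
      using slash_slash[of g "hecke_rep m p" z k f] det_SL2Z[OF g] det_hecke_rep[OF p m] m z
      by (simp add: D)
    thus "1 / of_nat \<delta> ^ k * slash k f g ((of_nat \<alpha> * z + of_int (int \<beta>)) / of_nat \<delta>) = slash k f D z"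
      by (simp add: hecke_rep_def p_eq slash_upper \<delta>_def)
  qed
  thus ?thesis by blast
qed

text \<open>The conjugate by \<open>A\<close> of the translation by \<open>N\<close> is the identity modulo \<open>N\<close>, and so it lies in \<open>\<Gamma>\<^sub>0(N)\<close>.\<close>

lemma slash_periodic:
  assumes f: "\<And>A z. A \<in> Gamma0 N \<Longrightarrow> Im z > 0 \<Longrightarrow> slash k f A z = f z"
    and A: "A \<in> SL2Z" and z: "Im z > 0"
  shows "slash k f A (z + of_nat N) = slash k f A z"
proof -
  let ?T = "mat2 1 (int N) 0 1"
  obtain a b c d where Am: "A = mat2 a b c d" by (rule mat2_cases)
  have A': "adj2 A \<in> SL2Z" "adj2 A ** A = mat 1" using adj2_SL2Z[OF A] by auto
  define g where "g = A ** ?T ** adj2 A"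
  have g: "g \<in> Gamma0 N"
  proof -
    have "g \<in> SL2Z" unfolding g_def using A A' by (intro SL2Z_mult) auto
    moreover have "int N dvd g $ 2 $ 1" by (simp add: g_def Am algebra_simps)
    ultimately show ?thesis by (simp add: Gamma0_def)
  qed
  have gA: "g ** A = A ** ?T" by (simp add: g_def matrix_mul_assoc[symmetric] A')
  have "slash k f A (z + of_nat N) = slash k (slash k f A) ?T z"
    by (simp add: slash_upper)
  also have "\<dots> = slash k f (g ** A) z"
    unfolding gA by (rule slash_slash) (use det_SL2Z[OF A] z in auto)
  also have "\<dots> = slash k (slash k f g) A z"
    by (rule slash_slash[symmetric]) (use det_SL2Z[OF A] det_Gamma0[OF g] z in auto)
  also have "\<dots> = slash k f A z"
    by (rule slash_cong) (use f[OF g] det_SL2Z[OF A] z in auto)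
  finally show ?thesis .
qed

text \<open>Right multiplication by an element of \<open>\<Gamma>\<^sub>0(N)\<close> permutes the cosets \<open>\<Gamma>\<^sub>0(N) \<delta>\<close> of the Hecke representatives, and
  \<open>f\<close> slashed by \<open>\<delta>\<close> depends only on the coset.\<close>

lemma hecke_invariant:
  assumes f: "f \<in> modular_forms k N" and m: "m > 0" and A: "A \<in> Gamma0 N" and z: "Im z > 0"
  shows "slash k (hecke k N m f) A z = hecke k N m f z"
proof -
  let ?P = "hecke_index N m"
  have Apos: "det A > 0" using det_Gamma0[OF A] by simp
  have ex: "\<exists>q. q \<in> ?P \<and> (\<exists>g\<in>Gamma0 N. hecke_rep m p ** A = g ** hecke_rep m q)" if p: "p \<in> ?P" for p
  proof -
    obtain \<alpha> \<beta> where p_eq: "p = (\<alpha>, \<beta>)" by fastforce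
    obtain a b c d where Am: "A = mat2 a b c d" by (rule mat2_cases)
    have A': "a * d - b * c = 1" "int N dvd c" using A by (auto simp: Am)
    have "det (hecke_rep m p ** A) = int m"
      using det_hecke_rep[OF p m] det_Gamma0[OF A] by (simp add: det_mul)
    moreover have "int N dvd (hecke_rep m p ** A) $ 2 $ 1"
      using A' by (simp add: hecke_rep_def p_eq Am)
    moreover have "coprime ((hecke_rep m p ** A) $ 1 $ 1) (int N)"
    proof -
      obtain c' where c': "c = int N * c'" using A'(2) by (auto simp: dvd_def)
      have "a * d + int N * (- b * c') = 1" using A'(1) by (simp add: c' algebra_simps)
      hence "coprime a (int N)"
        by (intro coprimeI) (metis dvd_add dvd_mult2)
      moreover have "coprime (int \<alpha>) (int N)" using hecke_index_dvd(5)[OF p m] by (simp add: p_eq)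
      ultimately have "coprime (int \<alpha> * a) (int N)" by simp
      hence "coprime (int \<alpha> * a + int N * (int \<beta> * c')) (int N)"
        by (intro coprimeI) (meson coprime_common_divisor dvd_add_left_iff dvd_mult2)
      thus ?thesis by (simp add: hecke_rep_def p_eq Am c' algebra_simps)
    qed
    ultimately obtain g q where "g \<in> Gamma0 N" "q \<in> ?P" "hecke_rep m p ** A = g ** hecke_rep m q"
      using m by (elim decompose_upper_triangular[rotated 1]) auto
    thus ?thesis by blast
  qed
  hence "\<exists>\<sigma>. \<forall>p\<in>?P. \<sigma> p \<in> ?P \<and> (\<exists>g\<in>Gamma0 N. hecke_rep m p ** A = g ** hecke_rep m (\<sigma> p))"
    by (intro bchoice) blast
  then obtain \<sigma> where \<sigma>: "\<And>p. p \<in> ?P \<Longrightarrow> \<sigma> p \<in> ?P"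
    "\<And>p. p \<in> ?P \<Longrightarrow> \<exists>g\<in>Gamma0 N. hecke_rep m p ** A = g ** hecke_rep m (\<sigma> p)"
    by blast
  have "inj_on \<sigma> ?P"
  proof (rule inj_onI)
    fix p q assume pq: "p \<in> ?P" "q \<in> ?P" "\<sigma> p = \<sigma> q"
    obtain g where g: "g \<in> Gamma0 N" "hecke_rep m p ** A = g ** hecke_rep m (\<sigma> p)" using \<sigma>(2) pq by blast
    obtain h where h: "h \<in> Gamma0 N" "hecke_rep m q ** A = h ** hecke_rep m (\<sigma> p)" using \<sigma>(2)[OF pq(2)] pq(3) by auto
    have "hecke_rep m (\<sigma> p) = adj2 h ** (hecke_rep m q ** A)"
      using adj2_SL2Z(3)[OF Gamma0_subset_SL2Z[OF h(1)]] by (simp add: h matrix_mul_assoc)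
    hence "hecke_rep m p ** A ** adj2 A = (g ** adj2 h) ** hecke_rep m q ** (A ** adj2 A)"
      by (simp add: g matrix_mul_assoc)
    hence "hecke_rep m p = (g ** adj2 h) ** hecke_rep m q"
      using adj2_SL2Z(2)[OF Gamma0_subset_SL2Z[OF A]] by (simp add: matrix_mul_assoc[symmetric])
    thus "p = q" using hecke_rep_unique[OF _ pq(1,2) m] Gamma0_mult adj2_Gamma0 g(1) h(1) by blast
  qed
  moreover have "\<sigma> ` ?P \<subseteq> ?P" using \<sigma>(1) by blast
  ultimately have bij: "bij_betw \<sigma> ?P ?P"
    using endo_inj_surj[OF finite_hecke_index[OF m], of \<sigma>] by (simp add: bij_betw_def)
  have eq: "slash k (slash k f (hecke_rep m p)) A z = slash k f (hecke_rep m (\<sigma> p)) z" if p: "p \<in> ?P" for p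
  proof -
    obtain g where g: "g \<in> Gamma0 N" "hecke_rep m p ** A = g ** hecke_rep m (\<sigma> p)" using \<sigma>(2) p by blast
    have pos: "det (hecke_rep m p) > 0" "det (hecke_rep m (\<sigma> p)) > 0" "det g > 0"
      using det_hecke_rep[OF p m] det_hecke_rep[OF \<sigma>(1)[OF p] m] m det_Gamma0[OF g(1)] by auto
    have "slash k (slash k f (hecke_rep m p)) A z = slash k (slash k f g) (hecke_rep m (\<sigma> p)) z"
      using slash_slash[OF pos(1) Apos z] slash_slash[OF pos(3,2) z] g by simp
    also have "\<dots> = slash k f (hecke_rep m (\<sigma> p)) z"
      by (rule slash_cong[OF _ pos(2) z]) (rule modular_form_invariant[OF f g(1)])
    finally show ?thesis .
  qed
  have "slash k (hecke k N m f) A z = of_nat m ^ (k - 1) * (\<Sum>p\<in>?P. slash k (slash k f (hecke_rep m p)) A z)"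
    unfolding hecke_eq_sum_slash[OF m, abs_def] slash_scale slash_sum ..
  also have "\<dots> = of_nat m ^ (k - 1) * (\<Sum>p\<in>?P. slash k f (hecke_rep m (\<sigma> p)) z)"
    using eq by simp
  also have "\<dots> = hecke k N m f z"
    unfolding hecke_eq_sum_slash[OF m]
    using sum.reindex_bij_betw[OF bij, of "\<lambda>p. slash k f (hecke_rep m p) z"] by simp
  finally show ?thesis .
qed

text \<open>Each summand has an expansion of period \<open>m N\<close> at every cusp. The sum is invariant under \<open>\<Gamma>\<^sub>0(N)\<close>, hence of
  period \<open>N\<close>, and its expansion can be rewritten with this period.\<close>

theorem hecke_modular_form:
  assumes f: "f \<in> modular_forms k N" and m: "m > 0" and N: "N > 0"
  shows "hecke k N m f \<in> modular_forms k N"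
proof (rule modular_formI)
  let ?P = "hecke_index N m"
  have Tf: "hecke k N m f = (\<lambda>z. of_nat m ^ (k - 1) * (\<Sum>p\<in>?P. slash k f (hecke_rep m p) z))"
    using hecke_eq_sum_slash[OF m] by (simp add: fun_eq_iff)
  show "hecke k N m f holomorphic_on \<H>"
    unfolding Tf using holomorphic_slash[OF holomorphic_modular_form[OF f]] det_hecke_rep m
    by (intro holomorphic_intros) auto
  show "hecke k N m f z = 0" if z: "\<not> Im z > 0" for z
  proof -
    have "slash k f (hecke_rep m p) z = 0" if p: "p \<in> ?P" for p
    proof -
      obtain \<alpha> \<beta> where p_eq: "p = (\<alpha>, \<beta>)" by fastforce
      have "\<not> Im ((of_nat \<alpha> * z + of_nat \<beta>) / of_nat (m div \<alpha>)) > 0"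
        using z hecke_index_dvd(2,3)[OF p m] by (simp add: p_eq Im_divide_of_nat zero_less_divide_iff zero_less_mult_iff)
      thus ?thesis using modular_form_off_H'[OF f] by (simp add: hecke_rep_def p_eq slash_upper)
    qed
    thus ?thesis unfolding Tf by simp
  qed
  show inv: "slash k (hecke k N m f) A z = hecke k N m f z" if "A \<in> Gamma0 N" "Im z > 0" for A z
    using hecke_invariant[OF f m that] .
  show "\<exists>a. has_fourier_expansion N (slash k (hecke k N m f) A) a" if A: "A \<in> SL2Z" for A
  proof -
    have "\<exists>a. has_fourier_expansion (m * N) (slash k (slash k f (hecke_rep m p)) A) a" if p: "p \<in> ?P" for p
    proof -
      have d: "det (hecke_rep m p) > 0" "det A > 0" using det_hecke_rep[OF p m] m det_SL2Z[OF A] by auto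
      obtain a where a: "has_fourier_expansion (m * N) (slash k f (hecke_rep m p ** A)) a"
        using expansion_slash_det[OF f N m, of "hecke_rep m p ** A"] det_hecke_rep[OF p m] det_SL2Z[OF A]
        by (auto simp: det_mul)
      have "has_fourier_expansion (m * N) (slash k (slash k f (hecke_rep m p)) A) a"
        by (rule fourier_expansion_cong[OF a]) (rule slash_slash[OF d, symmetric])
      thus ?thesis by blast
    qed
    hence "\<exists>a. \<forall>p\<in>?P. has_fourier_expansion (m * N) (slash k (slash k f (hecke_rep m p)) A) (a p)"
      by (intro bchoice) blast
    then obtain a where a: "\<And>p. p \<in> ?P \<Longrightarrow> has_fourier_expansion (m * N) (slash k (slash k f (hecke_rep m p)) A) (a p)"
      by blast
    have "has_fourier_expansion (m * N) (slash k (hecke k N m f) A)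
            (\<lambda>n. of_nat m ^ (k - 1) * (\<Sum>p\<in>?P. a p n))"
      unfolding Tf slash_scale slash_sum by (intro fourier_expansion_scale fourier_expansion_sum a)
    from fourier_expansion_reduce_period[OF this m N] slash_periodic[OF inv A]
    show ?thesis by blast
  qed
qed

section \<open>Modular forms are determined by finitely many coefficients\<close>

lemma modular_form_translate:
  assumes "f \<in> modular_forms k N" "Im z > 0"
  shows "f (z + 1) = f z"
  using modular_form_invariant[OF assms(1) _ assms(2), of "mat2 1 1 0 1"] by (simp add: slash_upper)

lemma fourier_coeff_eq:
  assumes "has_fourier_expansion 1 f a"
  shows "fourier_coeff f = a"
  unfolding fourier_coeff_def
  using assms by (intro the_equality) (auto intro: fourier_expansion_unique)

lemma fourier_coeff_expansion:
  assumes f: "f \<in> modular_forms k N" and N: "N > 0"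
  shows "has_fourier_expansion 1 f (fourier_coeff f)"
proof -
  obtain a where "has_fourier_expansion N (slash k f (mat 1)) a"
    using modular_form_expansion[OF f, of "mat 1"] by (auto simp: SL2Z_def)
  hence "has_fourier_expansion (N * 1) f a" by simp
  hence "has_fourier_expansion 1 f (\<lambda>n. a (N * n))"
    by (rule fourier_expansion_reduce_period) (use N modular_form_translate[OF f] in auto)
  thus ?thesis using fourier_coeff_eq by simp
qed

lemma modular_form_eqI:
  assumes "f \<in> modular_forms k N" "g \<in> modular_forms k N" "N > 0"
    "\<And>n. fourier_coeff f n = fourier_coeff g n"
  shows "f = g"
proof
  fix z
  have eq: "fourier_coeff f = fourier_coeff g" using assms(4) by blast
  show "f z = g z"
  proof (cases "Im z > 0")
    case True
    have "(\<lambda>n. fourier_coeff f n * qpar 1 z ^ n) sums f z"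
         "(\<lambda>n. fourier_coeff f n * qpar 1 z ^ n) sums g z"
      using fourier_coeff_expansion[OF assms(1,3)] fourier_coeff_expansion[OF assms(2,3)] True
      by (auto simp: has_fourier_expansion_qpar eq)
    thus ?thesis by (rule sums_unique2)
  qed (use modular_form_off_H'[OF assms(1)] modular_form_off_H'[OF assms(2)] in simp)
qed

text \<open>With \<open>D\<close> the diagonal matrix of entries \<open>2, 1\<close>, one has \<open>f(2z) = (f|D)(z)\<close>, and \<open>D\<close> conjugates \<open>\<Gamma>\<^sub>0(2N)\<close>
  into \<open>\<Gamma>\<^sub>0(N)\<close>.\<close>

lemma modular_forms_double:
  assumes f: "f \<in> modular_forms k N" and N: "N > 0"
  shows "(\<lambda>z. f (2 * z)) \<in> modular_forms k (2 * N)"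
proof (rule modular_formI)
  let ?D = "mat2 2 0 0 1"
  have D: "slash k f ?D = (\<lambda>z. f (2 * z))" by (simp add: fun_eq_iff slash_upper)
  show "(\<lambda>z. f (2 * z)) holomorphic_on \<H>"
    unfolding D[symmetric] by (rule holomorphic_slash[OF holomorphic_modular_form[OF f]]) simp
  show "f (2 * z) = 0" if "\<not> Im z > 0" for z
    using modular_form_off_H'[OF f, of "2 * z"] that by simp
  show "slash k (\<lambda>z. f (2 * z)) A z = f (2 * z)" if A: "A \<in> Gamma0 (2 * N)" and z: "Im z > 0" for A z
  proof -
    obtain a b c d where Am: "A = mat2 a b c d" by (rule mat2_cases)
    have abcd: "a * d - b * c = 1" "int (2 * N) dvd c" using A by (auto simp: Am)
    then obtain c' where "c = int (2 * N) * c'" by (elim dvdE)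
    hence c': "c = 2 * (int N * c')" by simp
    let ?g = "mat2 a (2 * b) (int N * c') d"
    have g: "?g \<in> Gamma0 N" using abcd(1) by (simp add: c' algebra_simps)
    have "slash k (slash k f ?D) A z = slash k f (?D ** A) z"
      by (rule slash_slash) (use det_Gamma0[OF A] z in auto)
    also have "?D ** A = ?g ** ?D" by (simp add: Am c')
    also have "slash k f (?g ** ?D) z = slash k (slash k f ?g) ?D z"
      by (rule slash_slash[symmetric]) (use det_Gamma0[OF g] z in auto)
    also have "\<dots> = slash k f ?D z"
      by (rule slash_cong) (use modular_form_invariant[OF f g] z in auto)
    finally show ?thesis by (simp add: D)
  qed
  show "\<exists>a. has_fourier_expansion (2 * N) (slash k (\<lambda>z. f (2 * z)) A) a" if A: "A \<in> SL2Z" for A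
  proof -
    have "det (?D ** A) = int 2" using det_SL2Z[OF A] by (simp add: det_mul)
    then obtain a where a: "has_fourier_expansion (2 * N) (slash k f (?D ** A)) a"
      using expansion_slash_det[OF f N, of 2 "?D ** A"] by auto
    have "has_fourier_expansion (2 * N) (slash k (slash k f ?D) A) a"
      by (rule fourier_expansion_cong[OF a], rule slash_slash[symmetric])
         (use det_SL2Z[OF A] in auto)
    thus ?thesis unfolding D by blast
  qed
qed

lemma modular_forms_multiple_level:
  assumes f: "f \<in> modular_forms k N" and m: "m > 0"
  shows "f \<in> modular_forms k (m * N)"
proof (rule modular_formI)
  show "slash k f A z = f z" if "A \<in> Gamma0 (m * N)" "Im z > 0" for A z
    using modular_form_invariant[OF f, of A z] that by (auto simp: Gamma0_def intro: dvd_mult_right)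
  show "\<exists>a. has_fourier_expansion (m * N) (slash k f A) a" if "A \<in> SL2Z" for A
    using modular_form_expansion[OF f that] fourier_expansion_rescale[OF m] by blast
qed (use holomorphic_modular_form[OF f] modular_form_off_H'[OF f] in auto)

text \<open>The constant term is not assumed to vanish. It cancels in \<open>h(z) = f(z) - f(2z)\<close>, a form of level \<open>2N\<close> to which
  Siegel's bound applies. From \<open>h = 0\<close> one reads off \<open>a\<^sub>j = 0\<close> for odd \<open>j\<close> and \<open>a\<^bsub>2j\<^esub> = a\<^sub>j\<close>, so only \<open>a\<^sub>0\<close> can
  survive, and a nonzero constant does not have positive weight.\<close>

theorem modular_form_zero_of_coeffs:
  assumes f: "f \<in> modular_forms k N" and N: "N > 0" and k: "k > 0"
    and R: "covers_cosets (2 * N) R" and n: "k * card R \<le> n + 1"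
    and zero: "\<And>j. j \<in> {1..n} \<Longrightarrow> fourier_coeff f j = 0"
  shows "f = (\<lambda>_. 0)"
proof -
  define a where "a = fourier_coeff f"
  define b where "b = (\<lambda>j. a j - spread 2 a j)"
  define h where "h = (\<lambda>z. f z - f (2 * z))"
  have a: "has_fourier_expansion 1 f a" unfolding a_def by (rule fourier_coeff_expansion[OF f N])
  have "has_fourier_expansion 1 (\<lambda>z. f (2 * z)) (spread 2 a)"
    using fourier_expansion_affine[OF a, of 2 1 0] by simp
  hence b: "has_fourier_expansion 1 h b"
    unfolding h_def b_def by (intro fourier_expansion_diff a)
  have h: "h \<in> modular_forms k (2 * N)"
    unfolding h_def using modular_forms_double[OF f N] modular_forms_multiple_level[OF f, of 2]
    by (intro modular_forms_diff) auto
  have b0: "b j = 0" if "j \<le> n" for j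
  proof (cases "j = 0")
    case False
    hence "j div 2 \<in> {1..n}" if "even j" using that \<open>j \<le> n\<close> by (auto elim!: evenE)
    thus ?thesis using zero[of j] zero[of "j div 2"] False \<open>j \<le> n\<close>
      by (auto simp: b_def spread_def a_def)
  qed (simp add: b_def spread_def)
  have h0: "h z = 0" for z
  proof (rule sturm_bound[OF h _ k R])
    show "has_fourier_expansion (2 * N) h (spread (2 * N) b)"
      using fourier_expansion_rescale[of "2 * N" 1 h b] N b by simp
    show "spread (2 * N) b j = 0" if "j < 2 * N * (n + 1)" for j
      using that b0[of "j div (2 * N)"] N
      by (auto simp: spread_def div_less_iff_less_mult less_Suc_eq_le[symmetric] mult.commute)
    show "2 * N * k * card R \<le> 2 * N * (n + 1)"
      using mult_le_mono2[OF n, of "2 * N"] by (simp only: mult.assoc)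
  qed (use N in simp)
  have "b j = 0" for j by (rule fourier_expansion_zero[OF b]) (auto simp: h0)
  hence rec: "a j = spread 2 a j" for j by (simp add: b_def)
  have pos: "a j = 0" if "j > 0" for j
    using that
  proof (induction j rule: less_induct)
    case (less j)
    show ?case using rec[of j] less by (auto simp: spread_def elim!: evenE)
  qed
  have f_const: "f z = a 0" if z: "Im z > 0" for z
  proof -
    have "(\<lambda>j. a j * qpar 1 z ^ j) sums f z" using a z by (simp add: has_fourier_expansion_qpar)
    moreover have "(\<lambda>j. a j * qpar 1 z ^ j) sums (\<Sum>j\<in>{0}. a j * qpar 1 z ^ j)"
      by (rule sums_finite) (use pos in auto)
    ultimately show ?thesis using sums_unique2 by fastforce
  qed
  have "a 0 = 0"
  proof (rule ccontr)
    assume nz: "a 0 \<noteq> 0"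
    \<comment> \<open>At \<open>z = i\<close> the automorphy factor \<open>N i + 1\<close> of this matrix has absolute value greater than \<open>1\<close>.\<close>
    let ?A = "mat2 1 0 (int N) 1"
    have "slash k f ?A \<i> = f \<i>" by (rule modular_form_invariant[OF f]) auto
    moreover have "f (moebius_action ?A \<i>) = a 0"
      by (intro f_const moebius_in_H) auto
    ultimately have "a 0 / automorphy_factor ?A \<i> ^ k = a 0"
      using f_const[of \<i>] by (simp add: slash_def)
    moreover have "automorphy_factor ?A \<i> \<noteq> 0" by (rule Im_automorphy_nz) auto
    ultimately have "automorphy_factor ?A \<i> ^ k = 1" using nz by (simp add: divide_eq_eq)
    hence "norm (automorphy_factor ?A \<i>) ^ k = 1" by (metis norm_one norm_power)
    hence "norm (automorphy_factor ?A \<i>) = 1" using k power_eq_1_iff[of "norm (automorphy_factor ?A \<i>)" k] by simp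
    hence "norm (automorphy_factor ?A \<i>) ^ 2 = 1" by simp
    thus False using N by (simp add: automorphy_factor_def cmod_power2)
  qed
  hence "f z = 0" for z using f_const[of z] modular_form_off_H'[OF f, of z] by (cases "Im z > 0") auto
  thus ?thesis by blast
qed

section \<open>Hecke operators on Fourier coefficients\<close>

definition hecke_seq :: "nat \<Rightarrow> nat \<Rightarrow> nat \<Rightarrow> (nat \<Rightarrow> complex) \<Rightarrow> nat \<Rightarrow> complex" where
  "hecke_seq k N m c r =
     (\<Sum>a | a dvd m \<and> a dvd r \<and> coprime a N. of_nat a ^ (k - 1) * c (m div a * (r div a)))"

lemma root_of_unity_sum:
  assumes "d > 0"
  shows "(\<Sum>b<d. (exp (2 * of_real pi * \<i> / of_nat d) ^ b) ^ j) = (if d dvd j then of_nat d else (0::complex))"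
proof -
  let ?x = "exp (2 * of_real pi * \<i> / of_nat d) ^ j"
  have x: "?x = exp (2 * of_real pi * \<i> * of_nat j / of_nat d)"
    by (subst exp_of_nat_mult [symmetric]) (simp add: algebra_simps)
  have x1: "?x = 1 \<longleftrightarrow> d dvd j" unfolding x using complex_root_unity_eq_1[of d j] assms by simp
  have "?x ^ d = exp (2 * of_real pi * \<i>) ^ j"
    using assms unfolding power_mult[symmetric] exp_of_nat_mult[symmetric] by (simp add: field_simps)
  hence "?x ^ d = 1" by simp
  hence "(\<Sum>b<d. ?x ^ b) = (if d dvd j then of_nat d else 0)"
    using x1 geometric_sum[of ?x d] by auto
  thus ?thesis by (simp add: power_mult[symmetric] mult.commute)
qed

text \<open>Summation over \<open>b < d\<close> in the definition picks out the coefficients whose index is divisible by \<open>d = m/a\<close>.\<close>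

lemma hecke_expansion:
  assumes c: "has_fourier_expansion 1 f c" and m: "m > 0" and k: "k > 0"
  shows "has_fourier_expansion 1 (hecke k N m f) (hecke_seq k N m c)"
  unfolding has_fourier_expansion_qpar
proof (intro allI impI)
  fix z :: complex assume z: "Im z > 0"
  let ?A = "{a. a dvd m \<and> coprime a N}"
  define q where "q = qpar 1 z"
  have fin: "finite ?A" using m by simp
  have inner: "(\<lambda>r. spread a (\<lambda>l. of_nat d * c (d * l)) r * q ^ r) sums
                 (\<Sum>b<d. f ((of_nat a * z + of_nat b) / of_nat d))"
    if a: "a \<in> ?A" and d: "d = m div a" for a d
  proof -
    have a0: "a > 0" and d0: "d > 0" using a d m by (auto simp: dvd_div_eq_0_iff intro!: Nat.gr0I)
    define \<zeta> where "\<zeta> = exp (2 * of_real pi * \<i> / of_nat d)"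
    define Q where "Q = qpar 1 (of_nat a * z / of_nat d)"
    have Qd: "Q ^ d = q ^ a"
      unfolding Q_def q_def qpar_power using d0 by (simp add: mult.assoc)
    have "(\<lambda>j. c j * (Q * \<zeta> ^ b) ^ j) sums f ((of_nat a * z + of_nat b) / of_nat d)" for b
    proof -
      have "qpar 1 ((of_nat a * z + of_nat b) / of_nat d) = Q * \<zeta> ^ b"
        unfolding Q_def \<zeta>_def qpar_def exp_of_nat_mult[symmetric] exp_add[symmetric]
        using d0 by (simp add: field_simps)
      moreover have "Im ((of_nat a * z + of_nat b) / of_nat d) > 0"
        using z a0 d0 by simp
      ultimately show ?thesis using c unfolding has_fourier_expansion_qpar by metis
    qed
    hence "(\<lambda>j. \<Sum>b<d. c j * (Q * \<zeta> ^ b) ^ j) sums (\<Sum>b<d. f ((of_nat a * z + of_nat b) / of_nat d))"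
      by (intro sums_sum)
    moreover have "(\<Sum>b<d. c j * (Q * \<zeta> ^ b) ^ j) = c j * Q ^ j * (if d dvd j then of_nat d else 0)" for j
      using root_of_unity_sum[OF d0, of j, folded \<zeta>_def]
      by (simp add: power_mult_distrib sum_distrib_left[symmetric] mult.assoc)
    ultimately have *: "(\<lambda>j. c j * Q ^ j * (if d dvd j then of_nat d else 0)) sums
         (\<Sum>b<d. f ((of_nat a * z + of_nat b) / of_nat d))" by simp
    have "strict_mono (\<lambda>l. d * l)" using d0 by (simp add: strict_mono_def)
    moreover have "c j * Q ^ j * (if d dvd j then of_nat d else 0) = 0" if "j \<notin> range (\<lambda>l. d * l)" for j
      using that by (auto simp: dvd_def)
    ultimately have "(\<lambda>l. c (d * l) * Q ^ (d * l) * (if d dvd d * l then of_nat d else 0)) sums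
         (\<Sum>b<d. f ((of_nat a * z + of_nat b) / of_nat d))"
      using * sums_mono_reindex[of "\<lambda>l. d * l" "\<lambda>j. c j * Q ^ j * (if d dvd j then of_nat d else 0)"] by blast
    hence "(\<lambda>l. (of_nat d * c (d * l)) * (q ^ a) ^ l) sums (\<Sum>b<d. f ((of_nat a * z + of_nat b) / of_nat d))"
      by (simp add: power_mult Qd mult.commute[of _ "of_nat d"] mult.assoc)
    thus ?thesis by (subst sums_spread[OF a0])
  qed
  have "(\<lambda>r. of_nat m ^ (k - 1) * (\<Sum>a\<in>?A. spread a (\<lambda>l. of_nat (m div a) * c (m div a * l)) r * q ^ r / of_nat (m div a) ^ k))
          sums (of_nat m ^ (k - 1) * (\<Sum>a\<in>?A. (\<Sum>b<m div a. f ((of_nat a * z + of_nat b) / of_nat (m div a))) / of_nat (m div a) ^ k))"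
    by (intro sums_mult sums_sum sums_divide inner) auto
  also have "(of_nat m ^ (k - 1) * (\<Sum>a\<in>?A. (\<Sum>b<m div a. f ((of_nat a * z + of_nat b) / of_nat (m div a))) / of_nat (m div a) ^ k))
       = hecke k N m f z"
    by (simp add: hecke_def Let_def sum_divide_distrib)
  also have "(\<lambda>r. of_nat m ^ (k - 1) * (\<Sum>a\<in>?A. spread a (\<lambda>l. of_nat (m div a) * c (m div a * l)) r * q ^ r / of_nat (m div a) ^ k))
       = (\<lambda>r. hecke_seq k N m c r * q ^ r)"
  proof
    fix r
    have "of_nat m ^ (k - 1) * (\<Sum>a\<in>?A. spread a (\<lambda>l. of_nat (m div a) * c (m div a * l)) r * q ^ r / of_nat (m div a) ^ k)
       = (\<Sum>a\<in>?A. if a dvd r then of_nat a ^ (k - 1) * c (m div a * (r div a)) * q ^ r else 0)"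
      unfolding sum_distrib_left
    proof (rule sum.cong)
      fix a assume a: "a \<in> ?A"
      define d where "d = m div a"
      have md: "m = a * d" using a by (simp add: d_def)
      have d0: "d > 0" using md m by (auto intro!: Nat.gr0I)
      obtain k' where k': "k = Suc k'" using k by (cases k) auto
      show "of_nat m ^ (k - 1) * (spread a (\<lambda>l. of_nat (m div a) * c (m div a * l)) r * q ^ r / of_nat (m div a) ^ k)
          = (if a dvd r then of_nat a ^ (k - 1) * c (m div a * (r div a)) * q ^ r else 0)"
        unfolding d_def[symmetric] using d0
        by (simp add: spread_def k' md power_mult_distrib field_simps)
    qed simp
    also have "\<dots> = (\<Sum>a | a dvd m \<and> a dvd r \<and> coprime a N. of_nat a ^ (k - 1) * c (m div a * (r div a)) * q ^ r)"
      using fin by (intro sum.mono_neutral_cong_right) auto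
    also have "\<dots> = hecke_seq k N m c r * q ^ r"
      by (simp add: hecke_seq_def sum_distrib_right)
    finally show "of_nat m ^ (k - 1) * (\<Sum>a\<in>?A. spread a (\<lambda>l. of_nat (m div a) * c (m div a * l)) r * q ^ r / of_nat (m div a) ^ k)
       = hecke_seq k N m c r * q ^ r" .
  qed
  finally show "(\<lambda>r. hecke_seq k N m c r * qpar 1 z ^ r) sums hecke k N m f z"
    by (simp add: q_def)
qed

text \<open>This symmetry makes \<open>(T\<^sub>m, f) \<mapsto> a\<^sub>1(T\<^sub>m f)\<close> a duality between Hecke operators and forms.\<close>

lemma hecke_seq_sym: "hecke_seq k N m c r = hecke_seq k N r c m"
  unfolding hecke_seq_def by (intro sum.cong) (auto simp: mult.commute)

lemma hecke_seq_1: "hecke_seq k N m c 1 = c m"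
proof -
  have "{a. a dvd m \<and> a dvd Suc 0 \<and> coprime a N} = {1}" by auto
  thus ?thesis by (simp add: hecke_seq_def)
qed

text \<open>With \<open>m = a d\<close> and \<open>n = b e\<close>, write \<open>b = \<beta>g\<close>, \<open>d = \<delta>g\<close>, \<open>a = \<alpha>h\<close>, \<open>e = \<epsilon>h\<close>. Passing from \<open>(a, b)\<close> to \<open>(\<alpha>g, \<beta>h)\<close> keeps
  the product \<open>ab\<close> and exchanges the two gcds \<open>g\<close> and \<open>h\<close>; it is an involution on pairs of divisors.\<close>

lemma divisor_pair_exchange:
  fixes m n a b :: nat
  assumes "m > 0" "n > 0" "a dvd m" "b dvd n"
  defines "g \<equiv> gcd b (m div a)" and "h \<equiv> gcd a (n div b)"
  defines "a' \<equiv> a div h * g" and "b' \<equiv> b div g * h"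
  shows "a' dvd m" "b' dvd n" "a' * b' = a * b"
    "gcd b' (m div a') = h" "gcd a' (n div b') = g"
    "a' div g * h = a" "b' div h * g = b"
proof -
  define d e where "d = m div a" and "e = n div b"
  have md: "m = a * d" "n = b * e" using assms by (simp_all add: d_def e_def)
  have pos: "a > 0" "b > 0" "d > 0" "e > 0" using md assms(1,2) by (auto intro!: Nat.gr0I)
  have g: "g > 0" "g = gcd b d" and h: "h > 0" "h = gcd a e"
    using pos by (simp_all add: g_def h_def d_def e_def)
  obtain \<beta> \<delta> where bd: "b = \<beta> * g" "d = \<delta> * g" "coprime \<beta> \<delta>"
    using gcd_coprime_exists[of b d, folded g(2)] g(1) by blast
  obtain \<alpha> \<epsilon> where ae: "a = \<alpha> * h" "e = \<epsilon> * h" "coprime \<alpha> \<epsilon>"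
    using gcd_coprime_exists[of a e, folded h(2)] h(1) by blast
  have a': "a' = \<alpha> * g" and b': "b' = \<beta> * h"
    using g(1) h(1) by (simp_all add: a'_def b'_def ae bd)
  have z: "\<alpha> > 0" "\<beta> > 0" "\<delta> > 0" "\<epsilon> > 0" using pos by (simp_all add: ae bd)
  have m': "m = a' * (\<delta> * h)" and n': "n = b' * (\<epsilon> * g)"
    by (simp_all add: md a' b' ae bd)
  show "a' dvd m" "b' dvd n" using m' n' by simp_all
  show "a' * b' = a * b" by (simp add: a' b' ae bd)
  have "m div a' = \<delta> * h" "n div b' = \<epsilon> * g"
    using z g(1) h(1) by (simp_all add: m' n') (simp_all add: a' b')
  moreover have "gcd (h * \<beta>) (h * \<delta>) = h" "gcd (g * \<alpha>) (g * \<epsilon>) = g"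
    using bd(3) ae(3) unfolding gcd_mult_distrib_nat[symmetric] by simp_all
  ultimately show "gcd b' (m div a') = h" "gcd a' (n div b') = g"
    by (simp_all only: a' b' mult.commute)
  show "a' div g * h = a" "b' div h * g = b" using g(1) h(1) by (simp_all add: a' b' ae bd)
qed

lemma divisor_condition:
  fixes m n a b r :: nat
  assumes "m > 0" "a dvd m"
  shows "a dvd r \<and> b dvd m div a * (r div a) \<longleftrightarrow> a * b dvd r * gcd b (m div a)"
proof -
  define d where "d = m div a"
  have md: "m = a * d" using assms by (simp add: d_def)
  have pos: "a > 0" "d > 0" using md assms(1) by (auto intro!: Nat.gr0I)
  define g where "g = gcd b d"
  have g: "g > 0" using pos by (simp add: g_def)
  obtain \<beta> \<delta> where bd: "b = \<beta> * g" "d = \<delta> * g" "coprime \<beta> \<delta>"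
    using gcd_coprime_exists[of b d, folded g_def] g by blast
  have "a dvd r \<and> b dvd d * (r div a) \<longleftrightarrow> a * b dvd r * g"
  proof
    assume *: "a dvd r \<and> b dvd d * (r div a)"
    then obtain r' where r': "r = a * r'" by (auto simp: dvd_def)
    have "\<beta> * g dvd (\<delta> * r') * g" using * pos by (simp add: r' bd mult_ac)
    hence "\<beta> dvd \<delta> * r'" using g by simp
    hence "\<beta> dvd r'" using bd(3) by (simp add: coprime_dvd_mult_right_iff)
    thus "a * b dvd r * g" by (simp add: r' bd mult_ac)
  next
    assume "a * b dvd r * g"
    hence "(a * \<beta>) * g dvd r * g" by (simp add: bd mult_ac)
    hence "a * \<beta> dvd r" using g by simp
    then obtain t where t: "r = a * \<beta> * t" by (auto simp: dvd_def)
    show "a dvd r \<and> b dvd d * (r div a)" using pos by (simp add: t bd)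
  qed
  thus ?thesis by (simp add: d_def g_def)
qed

text \<open>Composites involve \<open>(a, b)\<close> only through \<open>ab\<close> and \<open>gcd b (m div a)\<close>. In this form the effect of interchanging the
  two operators is to replace the gcd by \<open>gcd a (n div b)\<close>.\<close>

lemma hecke_seq_hecke_seq:
  assumes m: "m > 0" and n: "n > 0"
  shows "hecke_seq k N m (hecke_seq k N n c) r =
    (\<Sum>(a, b) | a dvd m \<and> b dvd n \<and> coprime (a * b) N \<and> a * b dvd r * gcd b (m div a).
        of_nat (a * b) ^ (k - 1) * c (m * n * r div (a * b)^2))"
proof -
  let ?A = "{a. a dvd m \<and> a dvd r \<and> coprime a N}"
  let ?B = "\<lambda>a. {b. b dvd n \<and> b dvd m div a * (r div a) \<and> coprime b N}"
  have "hecke_seq k N m (hecke_seq k N n c) r =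
      (\<Sum>a\<in>?A. \<Sum>b\<in>?B a. of_nat a ^ (k - 1) * (of_nat b ^ (k - 1) * c (n div b * (m div a * (r div a) div b))))"
    by (simp add: hecke_seq_def sum_distrib_left)
  also have "\<dots> = (\<Sum>(a, b)\<in>Sigma ?A ?B. of_nat a ^ (k - 1) * (of_nat b ^ (k - 1) * c (n div b * (m div a * (r div a) div b))))"
    using m n by (intro sum.Sigma) auto
  also have "\<dots> = (\<Sum>(a, b) | a dvd m \<and> b dvd n \<and> coprime (a * b) N \<and> a * b dvd r * gcd b (m div a).
        of_nat (a * b) ^ (k - 1) * c (m * n * r div (a * b)^2))"
  proof (intro sum.cong, goal_cases)
    case 1
    show ?case using divisor_condition[OF m] by (auto simp: coprime_mult_left_iff)
  next
    case (2 p)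
    obtain a b where p: "p = (a, b)" by fastforce
    have ab: "a dvd m" "b dvd n" "a * b dvd r * gcd b (m div a)" using 2 by (auto simp: p)
    have ab': "a dvd r" "b dvd m div a * (r div a)" using divisor_condition[OF m ab(1)] ab(3) by auto
    obtain d e r' where der: "m = a * d" "n = b * e" "r = a * r'" using ab ab' by (auto simp: dvd_def)
    have pos: "a > 0" "b > 0" using der m n by (auto intro!: Nat.gr0I)
    obtain s where s: "d * r' = b * s" using ab'(2) pos by (auto simp: der dvd_def)
    have "m * n * r = a * b * e * a * (d * r')" by (simp add: der mult_ac)
    also have "\<dots> = (a * b)^2 * (e * s)" by (simp add: s power2_eq_square mult_ac)
    finally have "m * n * r div (a * b)^2 = e * s" using pos by simp
    moreover have "n div b * (m div a * (r div a) div b) = e * s"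
      using pos by (simp add: der s)
    ultimately show ?case by (simp add: p power_mult_distrib mult.assoc)
  qed
  finally show ?thesis .
qed

text \<open>The involution \<open>divisor_pair_exchange\<close> matches the two sums term by term. It
  avoids the usual reduction to prime powers.\<close>

lemma hecke_seq_commute:
  assumes m: "m > 0" and n: "n > 0"
  shows "hecke_seq k N m (hecke_seq k N n c) r = hecke_seq k N n (hecke_seq k N m c) r"
proof -
  let ?g = "\<lambda>a b. gcd b (m div a)" and ?h = "\<lambda>a b. gcd a (n div b)"
  let ?\<phi> = "\<lambda>(a, b). (b div ?g a b * ?h a b, a div ?h a b * ?g a b)"
  let ?\<psi> = "\<lambda>(b, a). (a div ?h a b * ?g a b, b div ?g a b * ?h a b)"
  note ex = divisor_pair_exchange[OF m n]
  show ?thesis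
    unfolding hecke_seq_hecke_seq[OF m n] hecke_seq_hecke_seq[OF n m]
  proof (rule sum.reindex_bij_witness[where i = ?\<psi> and j = ?\<phi>], goal_cases)
    case (1 p)
    then obtain a b where p: "p = (a, b)" "a dvd m" "b dvd n" by auto
    show ?case using ex[OF p(2,3)] by (simp add: p)
  next
    case (2 p)
    then obtain a b where p: "p = (a, b)" "a dvd m" "b dvd n" 
      "coprime (a * b) N" "a * b dvd r * ?g a b" by auto
    have "b div ?g a b * ?h a b * (a div ?h a b * ?g a b) = a * b"
      using ex(3)[OF p(2,3)] by (simp only: mult.commute)
    thus ?case using ex(1,2,4,5)[OF p(2,3)] p(4,5) unfolding p(1)
      by (simp del: coprime_mult_left_iff)
  next
    case (3 p)
    then obtain a b where p: "p = (b, a)" "a dvd m" "b dvd n" by auto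
    show ?case using ex[OF p(2,3)] by (simp add: p)
  next
    case (4 p)
    then obtain a b where p: "p = (b, a)" "a dvd m" "b dvd n" 
      "coprime (a * b) N" "a * b dvd r * ?h a b" by (auto simp: mult.commute)
    have "a div ?h a b * ?g a b * (b div ?g a b * ?h a b) = a * b"
      using ex(3)[OF p(2,3)] by (simp only: mult.commute)
    thus ?case using ex(1,2,4,5)[OF p(2,3)] p(4,5) unfolding p(1)
      by (simp del: coprime_mult_left_iff)
  next
    case (5 p)
    then obtain a b where p: "p = (a, b)" "a dvd m" "b dvd n" by auto
    have "b div ?g a b * ?h a b * (a div ?h a b * ?g a b) = a * b"
      using ex(3)[OF p(2,3)] by (simp only: mult.commute)
    moreover have "n * m * r = m * n * r" by simp
    ultimately show ?case unfolding p(1) prod.case by (simp only:)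
  qed
qed

section \<open>The Hecke algebra and its pairing with modular forms\<close>

text \<open>A functional that vanishes on the common kernel of finitely many others is a combination of them. It is
  stated for functionals that are linear only on \<open>V\<close>, since Fourier coefficients are meaningful only for forms.\<close>

lemma functional_in_span:
  fixes lam :: "'i \<Rightarrow> form \<Rightarrow> complex" and mu :: "form \<Rightarrow> complex"
  assumes "finite I" "form_space.subspace V"
    and lin: "\<And>i f g. i \<in> I \<Longrightarrow> f \<in> V \<Longrightarrow> g \<in> V \<Longrightarrow> lam i (f + g) = lam i f + lam i g"
             "\<And>i f c. i \<in> I \<Longrightarrow> f \<in> V \<Longrightarrow> lam i (fscale c f) = c * lam i f"
    and lin': "\<And>f g. f \<in> V \<Longrightarrow> g \<in> V \<Longrightarrow> mu (f + g) = mu f + mu g"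
             "\<And>f c. f \<in> V \<Longrightarrow> mu (fscale c f) = c * mu f"
    and ker: "\<And>f. f \<in> V \<Longrightarrow> (\<And>i. i \<in> I \<Longrightarrow> lam i f = 0) \<Longrightarrow> mu f = 0"
  shows "\<exists>c. \<forall>f\<in>V. mu f = (\<Sum>i\<in>I. c i * lam i f)"
  using assms
proof (induction I arbitrary: V rule: finite_induct)
  case (insert j I V)
  note sub = insert.prems(1)
  let ?W = "{f \<in> V. lam j f = 0}"
  have addV: "f + g \<in> V" if "f \<in> V" "g \<in> V" for f g
    using that by (rule form_space.subspace_add[OF sub])
  have scaleV: "fscale c f \<in> V" if "f \<in> V" for c f
    using that by (rule form_space.subspace_scale[OF sub])
  have "lam j 0 = 0"
    using insert.prems(3)[of j 0 0] form_space.subspace_0[OF sub] by (simp add: fscale_def zero_fun_def)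
  hence "form_space.subspace ?W"
    using insert.prems(2)[of j] insert.prems(3)[of j] form_space.subspace_0[OF sub] addV scaleV
    by (intro form_space.subspaceI) (simp_all del: plus_fun_apply)
  hence "\<exists>c. \<forall>f\<in>?W. mu f = (\<Sum>i\<in>I. c i * lam i f)"
  proof (rule insert.IH)
    show "mu f = 0" if "f \<in> ?W" "\<And>i. i \<in> I \<Longrightarrow> lam i f = 0" for f
      using insert.prems(6)[of f] that by blast
  qed (use insert.prems(2-5) in blast)+
  then obtain c where c: "\<And>f. f \<in> V \<Longrightarrow> lam j f = 0 \<Longrightarrow> mu f = (\<Sum>i\<in>I. c i * lam i f)" by auto
  show ?case
  proof (cases "\<exists>f\<in>V. lam j f \<noteq> 0")
    case False
    have "\<forall>f\<in>V. mu f = (\<Sum>i\<in>insert j I. c i * lam i f)"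
      using c False insert.hyps by simp
    thus ?thesis by blast
  next
    case True
    then obtain f1 where f1: "f1 \<in> V" "lam j f1 \<noteq> 0" by blast
    define f0 where "f0 = fscale (1 / lam j f1) f1"
    have f0: "f0 \<in> V" "lam j f0 = 1"
      using f1 scaleV insert.prems(3)[of j f1] by (auto simp: f0_def)
    define t where "t = mu f0 - (\<Sum>i\<in>I. c i * lam i f0)"
    have "mu f = (\<Sum>i\<in>insert j I. (c(j := t)) i * lam i f)" if f: "f \<in> V" for f
    proof -
      let ?s = "- lam j f"
      have sV: "fscale ?s f0 \<in> V" by (rule scaleV[OF f0(1)])
      have l: "lam i (f + fscale ?s f0) = lam i f - lam j f * lam i f0" if "i \<in> insert j I" for i
        unfolding insert.prems(2)[OF that f sV] insert.prems(3)[OF that f0(1)] by simp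
      have "lam j (f + fscale ?s f0) = 0" unfolding l[OF insertI1] by (simp add: f0)
      hence "mu (f + fscale ?s f0) = (\<Sum>i\<in>I. c i * lam i (f + fscale ?s f0))"
        by (rule c[OF addV[OF f sV]])
      also have "\<dots> = (\<Sum>i\<in>I. c i * (lam i f - lam j f * lam i f0))"
        by (intro sum.cong refl) (simp only: l insertI2)
      finally have "mu (f + fscale ?s f0) = (\<Sum>i\<in>I. c i * (lam i f - lam j f * lam i f0))" .
      moreover have "mu (f + fscale ?s f0) = mu f - lam j f * mu f0"
        unfolding insert.prems(4)[OF f sV] insert.prems(5)[OF f0(1)] by simp
      ultimately have "mu f = lam j f * mu f0 + (\<Sum>i\<in>I. c i * (lam i f - lam j f * lam i f0))" by simp
      also have "(\<Sum>i\<in>I. c i * (lam i f - lam j f * lam i f0))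
          = (\<Sum>i\<in>I. c i * lam i f) - lam j f * (\<Sum>i\<in>I. c i * lam i f0)"
        by (simp add: right_diff_distrib sum_subtractf sum_distrib_left mult_ac)
      finally have "mu f = t * lam j f + (\<Sum>i\<in>I. c i * lam i f)"
        by (simp add: t_def algebra_simps)
      also have "(\<Sum>i\<in>I. c i * lam i f) = (\<Sum>i\<in>I. (c(j := t)) i * lam i f)"
        using insert.hyps by (intro sum.cong) auto
      finally show ?thesis using insert.hyps by simp
    qed
    thus ?thesis by blast
  qed
qed simp

lemma subspace_modular_forms: "form_space.subspace (modular_forms k N)"
  unfolding form_space.subspace_def fscale_def zero_fun_def plus_fun_def
  using modular_forms_zero modular_forms_add modular_forms_scale by blast

text \<open>The endomorphisms of the space of modular forms that commute with all Hecke operators. The duality argument uses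
  only these properties of an element of the Hecke algebra.\<close>

locale hecke_commuting =
  fixes k N :: nat and U :: "form \<Rightarrow> form"
  assumes off: "f \<notin> modular_forms k N \<Longrightarrow> U f = 0"
    and maps: "f \<in> modular_forms k N \<Longrightarrow> U f \<in> modular_forms k N"
    and add: "f \<in> modular_forms k N \<Longrightarrow> g \<in> modular_forms k N \<Longrightarrow> U (f + g) = U f + U g"
    and scale: "f \<in> modular_forms k N \<Longrightarrow> U (fscale c f) = fscale c (U f)"
    and commute: "f \<in> modular_forms k N \<Longrightarrow> r > 0 \<Longrightarrow>
                    hecke_op k N r (U f) = U (hecke_op k N r f)"
begin

lemma zero: "U 0 = 0"
  using scale[OF form_space.subspace_0[OF subspace_modular_forms], of 0]
  unfolding form_space.scale_zero_left .

end

context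
  fixes k N :: nat
  assumes k: "k > 0" and N: "N > 0"
begin

lemma fourier_coeff_add:
  assumes "f \<in> modular_forms k N" "g \<in> modular_forms k N"
  shows "fourier_coeff (f + g) n = fourier_coeff f n + fourier_coeff g n"
  using fourier_coeff_eq[OF fourier_expansion_add[OF fourier_coeff_expansion[OF assms(1) N]
          fourier_coeff_expansion[OF assms(2) N]]]
  by (simp add: plus_fun_def)

lemma fourier_coeff_scale:
  assumes "f \<in> modular_forms k N"
  shows "fourier_coeff (fscale c f) n = c * fourier_coeff f n"
  using fourier_coeff_eq[OF fourier_expansion_scale[OF fourier_coeff_expansion[OF assms N], of c]]
  by (simp add: fscale_def)

lemma hecke_op_in: "m > 0 \<Longrightarrow> f \<in> modular_forms k N \<Longrightarrow> hecke_op k N m f \<in> modular_forms k N"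
  using hecke_modular_form N by (simp add: hecke_op_def)

lemma fourier_coeff_hecke_op:
  assumes "m > 0" "f \<in> modular_forms k N"
  shows "fourier_coeff (hecke_op k N m f) = hecke_seq k N m (fourier_coeff f)"
  using fourier_coeff_eq[OF hecke_expansion[OF fourier_coeff_expansion[OF assms(2) N] assms(1) k]] assms(2)
  by (simp add: hecke_op_def)

lemma hecke_op_commute:
  assumes "m > 0" "n > 0" "f \<in> modular_forms k N"
  shows "hecke_op k N m (hecke_op k N n f) = hecke_op k N n (hecke_op k N m f)"
proof (rule modular_form_eqI[of _ k N])
  show "fourier_coeff (hecke_op k N m (hecke_op k N n f)) r = fourier_coeff (hecke_op k N n (hecke_op k N m f)) r" for r
    using assms hecke_seq_commute[of m n k N "fourier_coeff f" r]
    by (simp add: fourier_coeff_hecke_op hecke_op_in)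
qed (use assms N in \<open>auto intro: hecke_op_in\<close>)

lemma hecke_op_add:
  assumes "f \<in> modular_forms k N" "g \<in> modular_forms k N"
  shows "hecke_op k N m (f + g) = hecke_op k N m f + hecke_op k N m g"
proof -
  have "f + g \<in> modular_forms k N"
    using form_space.subspace_add[OF subspace_modular_forms] assms by blast
  thus ?thesis using assms
    by (simp add: hecke_op_def hecke_def Let_def fun_eq_iff add_divide_distrib sum.distrib distrib_left)
qed

lemma hecke_op_scale:
  assumes "f \<in> modular_forms k N"
  shows "hecke_op k N m (fscale c f) = fscale c (hecke_op k N m f)"
proof -
  have "fscale c f \<in> modular_forms k N"
    using form_space.subspace_scale[OF subspace_modular_forms] assms by blast
  thus ?thesis using assms
    by (simp add: hecke_op_def hecke_def Let_def fscale_def fun_eq_iff sum_distrib_left mult_ac)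
qed

lemma hecke_commuting_hecke_op:
  assumes "n > 0"
  shows "hecke_commuting k N (hecke_op k N n)"
proof
  show "hecke_op k N n f = 0" if "f \<notin> modular_forms k N" for f
    using that by (simp add: hecke_op_def)
  show "hecke_op k N r (hecke_op k N n f) = hecke_op k N n (hecke_op k N r f)"
    if "f \<in> modular_forms k N" "r > 0" for f r
    by (rule hecke_op_commute[OF that(2) assms that(1)])
qed (fact hecke_op_in[OF assms] hecke_op_add hecke_op_scale)+

lemma hecke_commuting_opscale:
  assumes "hecke_commuting k N S"
  shows "hecke_commuting k N (opscale c S)"
proof -
  interpret S: hecke_commuting k N S by fact
  note ap = opscale_def[of c S, THEN fun_cong]
  show ?thesis
  proof
    fix f g d r
    show "opscale c S f = 0" if "f \<notin> modular_forms k N"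
      unfolding ap S.off[OF that] by (rule form_space.scale_zero_right)
    assume f: "f \<in> modular_forms k N"
    show "opscale c S f \<in> modular_forms k N"
      unfolding ap by (rule form_space.subspace_scale[OF subspace_modular_forms S.maps[OF f]])
    show "opscale c S (f + g) = opscale c S f + opscale c S g" if "g \<in> modular_forms k N"
      unfolding ap S.add[OF f that] by (rule form_space.scale_right_distrib)
    show "opscale c S (fscale d f) = fscale d (opscale c S f)"
      unfolding ap S.scale[OF f] by (rule form_space.scale_left_commute)
    show "hecke_op k N r (opscale c S f) = opscale c S (hecke_op k N r f)" if "r > 0"
      unfolding ap hecke_op_scale[OF S.maps[OF f]] S.commute[OF f that] by (rule refl)
  qed
qed

lemma hecke_commuting_add:
  assumes "hecke_commuting k N S" "hecke_commuting k N T"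
  shows "hecke_commuting k N (S + T)"
proof -
  interpret S: hecke_commuting k N S by fact
  interpret T: hecke_commuting k N T by fact
  note ap = plus_fun_apply[of S T]
  show ?thesis
  proof
    fix f g c r
    show "(S + T) f = 0" if "f \<notin> modular_forms k N"
      unfolding ap[of f] S.off[OF that] T.off[OF that] by (rule add_0_left)
    assume f: "f \<in> modular_forms k N"
    show "(S + T) f \<in> modular_forms k N"
      unfolding ap[of f]
      by (rule form_space.subspace_add[OF subspace_modular_forms S.maps[OF f] T.maps[OF f]])
    show "(S + T) (f + g) = (S + T) f + (S + T) g" if g: "g \<in> modular_forms k N"
      unfolding ap[of f] ap[of g] ap[of "f + g"] S.add[OF f g] T.add[OF f g] by (simp only: add_ac)
    show "(S + T) (fscale c f) = fscale c ((S + T) f)"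
      unfolding ap[of f] ap[of "fscale c f"] S.scale[OF f] T.scale[OF f]
      by (rule form_space.scale_right_distrib[symmetric])
    show "hecke_op k N r ((S + T) f) = (S + T) (hecke_op k N r f)" if "r > 0"
      unfolding ap[of f] ap[of "hecke_op k N r f"] hecke_op_add[OF S.maps[OF f] T.maps[OF f]]
        S.commute[OF f that] T.commute[OF f that] by (rule refl)
  qed
qed

lemma hecke_commuting_comp:
  assumes "hecke_commuting k N S" "hecke_commuting k N T"
  shows "hecke_commuting k N (S \<circ> T)"
proof -
  interpret S: hecke_commuting k N S by fact
  interpret T: hecke_commuting k N T by fact
  note ap = o_apply[of S T]
  show ?thesis
  proof
    fix f g c r
    show "(S \<circ> T) f = 0" if "f \<notin> modular_forms k N"
      unfolding ap T.off[OF that] by (rule S.zero)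
    assume f: "f \<in> modular_forms k N"
    show "(S \<circ> T) f \<in> modular_forms k N"
      unfolding ap by (rule S.maps[OF T.maps[OF f]])
    show "(S \<circ> T) (f + g) = (S \<circ> T) f + (S \<circ> T) g" if g: "g \<in> modular_forms k N"
      unfolding ap T.add[OF f g] by (rule S.add[OF T.maps[OF f] T.maps[OF g]])
    show "(S \<circ> T) (fscale c f) = fscale c ((S \<circ> T) f)"
      unfolding ap T.scale[OF f] by (rule S.scale[OF T.maps[OF f]])
    show "hecke_op k N r ((S \<circ> T) f) = (S \<circ> T) (hecke_op k N r f)" if "r > 0"
      unfolding ap S.commute[OF T.maps[OF f] that] T.commute[OF f that] by (rule refl)
  qed
qed

lemma hecke_algebra_commuting:
  assumes "U \<in> hecke_algebra k N"
  shows "hecke_commuting k N U"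
  using assms
proof induction
  case (generator n)
  show ?case by (rule hecke_commuting_hecke_op) (use generator in simp)
qed (blast intro: hecke_commuting_opscale hecke_commuting_add hecke_commuting_comp)+

lemma zero_in: "(0 :: form) \<in> modular_forms k N"
  by (rule form_space.subspace_0[OF subspace_modular_forms])

lemma fourier_coeff_zero: "fourier_coeff 0 n = 0"
  using fourier_coeff_scale[OF zero_in, of 0 n] by simp

lemma sum_opscale_apply: "(\<Sum>i\<in>I. opscale (c i) (T i)) f = (\<Sum>i\<in>I. fscale (c i) (T i f))"
  by (induction I rule: infinite_finite_induct) (auto simp: opscale_def)

lemma fourier_coeff_sum:
  assumes "\<And>i. i \<in> I \<Longrightarrow> F i \<in> modular_forms k N"
  shows "(\<Sum>i\<in>I. fscale (c i) (F i)) \<in> modular_forms k N \<and>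
         fourier_coeff (\<Sum>i\<in>I. fscale (c i) (F i)) n = (\<Sum>i\<in>I. c i * fourier_coeff (F i) n)"
  using assms
proof (induction I rule: infinite_finite_induct)
  case (insert j I)
  have j: "fscale (c j) (F j) \<in> modular_forms k N"
    using insert.prems form_space.subspace_scale[OF subspace_modular_forms] by blast
  have I: "(\<Sum>i\<in>I. fscale (c i) (F i)) \<in> modular_forms k N"
    and IH: "fourier_coeff (\<Sum>i\<in>I. fscale (c i) (F i)) n = (\<Sum>i\<in>I. c i * fourier_coeff (F i) n)"
    using insert.IH insert.prems by blast+
  have Fj: "F j \<in> modular_forms k N" using insert.prems by blast
  show ?case
    unfolding sum.insert[OF insert.hyps] fourier_coeff_add[OF j I] fourier_coeff_scale[OF Fj] IH
    using form_space.subspace_add[OF subspace_modular_forms j I] by blast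
next
  case empty
  show ?case unfolding sum.empty using zero_in fourier_coeff_zero by blast
next
  case (infinite I)
  show ?case unfolding sum.infinite[OF infinite.hyps] using zero_in fourier_coeff_zero by blast
qed

text \<open>The argument is the duality described at the beginning: \<open>a\<^sub>r(U f) = a\<^sub>1(T\<^sub>r U f) = a\<^sub>1(U T\<^sub>r f) = \<Sum> c\<^sub>i a\<^sub>i(T\<^sub>r f) = \<Sum> c\<^sub>i a\<^sub>r(T\<^sub>i f)\<close>.
  The difference of the two sides then has vanishing coefficients of positive index, so the determinacy hypothesis applies.\<close>

theorem hecke_algebra_eq_span:
  assumes n: "n > 0"
    and det: "\<And>f. f \<in> modular_forms k N \<Longrightarrow> (\<And>j. j \<in> {1..n} \<Longrightarrow> fourier_coeff f j = 0) \<Longrightarrow> f = 0"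
  shows "hecke_algebra k N = operator_space.span (hecke_op k N ` {1..n})"
proof
  show "operator_space.span (hecke_op k N ` {1..n}) \<subseteq> hecke_algebra k N"
  proof (rule operator_space.span_minimal)
    have "opscale 0 (hecke_op k N 1) \<in> hecke_algebra k N"
      by (intro hecke_algebra.scale hecke_algebra.generator) simp
    thus "operator_space.subspace (hecke_algebra k N)"
      by (auto simp: operator_space.subspace_def intro: hecke_algebra.scale hecke_algebra.add)
  qed (auto intro: hecke_algebra.generator)
next
  show "hecke_algebra k N \<subseteq> operator_space.span (hecke_op k N ` {1..n})"
  proof
    fix U assume "U \<in> hecke_algebra k N"
    then interpret U: hecke_commuting k N U by (rule hecke_algebra_commuting)
    have "\<exists>c. \<forall>f\<in>modular_forms k N. fourier_coeff (U f) 1 = (\<Sum>i\<in>{1..n}. c i * fourier_coeff f i)"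
    proof (rule functional_in_span[OF _ subspace_modular_forms])
      show "fourier_coeff (U f) 1 = 0"
        if "f \<in> modular_forms k N" "\<And>i. i \<in> {1..n} \<Longrightarrow> fourier_coeff f i = 0" for f
        proof -
        have "f = 0" using that by (rule det)
        hence "U f = 0" by (simp only: U.zero)
        thus ?thesis by (simp only: fourier_coeff_zero)
      qed
    qed (simp_all only: finite_atLeastAtMost U.maps U.add U.scale fourier_coeff_add fourier_coeff_scale)
    then obtain c where c: "\<And>f. f \<in> modular_forms k N \<Longrightarrow>
        fourier_coeff (U f) 1 = (\<Sum>i\<in>{1..n}. c i * fourier_coeff f i)" by blast
    have "U = (\<Sum>i\<in>{1..n}. opscale (c i) (hecke_op k N i))"
    proof
      fix f
      show "U f = (\<Sum>i\<in>{1..n}. opscale (c i) (hecke_op k N i)) f"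
      proof (cases "f \<in> modular_forms k N")
        case f: True
        define g where "g = (\<Sum>i\<in>{1..n}. fscale (c i) (hecke_op k N i f))"
        have g: "g \<in> modular_forms k N" 
          and gc: "\<And>r. fourier_coeff g r = (\<Sum>i\<in>{1..n}. c i * fourier_coeff (hecke_op k N i f) r)"
          unfolding g_def using fourier_coeff_sum[of "{1..n}" "\<lambda>i. hecke_op k N i f" c] hecke_op_in f by auto
        have eq: "fourier_coeff (U f) r = fourier_coeff g r" if r: "r > 0" for r
        proof -
          have "fourier_coeff (U f) r = fourier_coeff (hecke_op k N r (U f)) 1"
            using U.maps[OF f] r by (simp add: fourier_coeff_hecke_op hecke_seq_1 del: One_nat_def)
          also have "\<dots> = (\<Sum>i\<in>{1..n}. c i * fourier_coeff (hecke_op k N r f) i)"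
            using U.commute[OF f r] c[OF hecke_op_in[OF r f]] by (simp only:)
          also have "\<dots> = fourier_coeff g r"
            unfolding gc using r f
            by (intro sum.cong) (auto simp: fourier_coeff_hecke_op hecke_seq_sym[of k N r])
          finally show ?thesis .
        qed
        define h where "h = U f + fscale (-1) g"
        have sg: "fscale (-1) g \<in> modular_forms k N"
          using form_space.subspace_scale[OF subspace_modular_forms g] .
        have "h = 0"
        proof (rule det)
          show "h \<in> modular_forms k N" unfolding h_def
            using form_space.subspace_add[OF subspace_modular_forms U.maps[OF f] sg] .
          show "fourier_coeff h j = 0" if "j \<in> {1..n}" for j
            unfolding h_def fourier_coeff_add[OF U.maps[OF f] sg] fourier_coeff_scale[OF g]
            using eq[of j] that by simp
        qed
        hence "U f = g" by (simp add: h_def)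
        thus ?thesis by (simp add: sum_opscale_apply g_def)
      next
        case False
        thus ?thesis using U.off by (simp add: sum_opscale_apply hecke_op_def)
      qed
    qed
    also have "\<dots> \<in> operator_space.span (hecke_op k N ` {1..n})"
      by (intro operator_space.span_sum operator_space.span_scale operator_space.span_base) auto
    finally show "U \<in> operator_space.span (hecke_op k N ` {1..n})" .
  qed
qed

end


theorem corollary4:
  fixes N k n :: nat and \<alpha> s\<^sub>N \<epsilon>\<^sub>N X :: real
  assumes "N \<ge> 1" and "squarefree N" and "k \<ge> 4"
    and RH: "\<And>M \<phi> s. M dvd N \<Longrightarrow> \<phi> \<in> L_family k M \<Longrightarrow>
               0 < Re s \<Longrightarrow> Re s < 1 \<Longrightarrow> L_function k \<phi> s = 0 \<Longrightarrow> Re s = 1/2"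
    and "\<alpha> = 2605 + 87 * real k + (248 + 6 * real k) * ln (real N)"
    and "s\<^sub>N = real (form_space.dim (cusp_forms k N))"
    and "\<epsilon>\<^sub>N = real (form_space.dim (eisenstein_space k N))"
    and "real n \<ge> real N * X"
    and "X \<ge> Max {6 * (real k + 1)^2, real N, 17.33}"
    and "X / ln X ^ 4 \<ge>
           60 * real k * (\<alpha> + 1)^2 * (\<epsilon>\<^sub>N + 1) * (s\<^sub>N + 1) * ln (\<epsilon>\<^sub>N + 3) * ln (s\<^sub>N + 3)"
    and "X powr (1/2) / ln X ^ 2 \<ge>
           Max {12 * (\<alpha> + 1) * s\<^sub>N * ln (s\<^sub>N + 3), real k * \<epsilon>\<^sub>N * (\<alpha> + 1)^2 + 1}"
    and "X powr (real k / 2) / ln X ^ 2 \<ge>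
           24 * real k * (\<alpha> + 1) * (\<epsilon>\<^sub>N + 1) * ln (\<epsilon>\<^sub>N + 3)"
  shows "hecke_algebra k N = operator_space.span (hecke_op k N ` {1..n})"
proof -
  have N: "N > 0" and k: "k > 0" using assms(1,3) by auto
  have X: "X \<ge> 17.33" using assms(9) by simp
  have lnN: "ln (real N) \<ge> 0" using N by simp
  have ln_ge_1: "ln x \<ge> 1" if "x \<ge> 3" for x :: real
    using that exp_le by (subst ln_ge_iff) auto
  have se: "s\<^sub>N \<ge> 0" "\<epsilon>\<^sub>N \<ge> 0" using assms(6,7) by auto
  have \<alpha>: "\<alpha> + 1 \<ge> 2606 + 248 * ln (real N)"
    using lnN mult_nonneg_nonneg[of "6 * real k" "ln (real N)"] assms(5) by (simp add: algebra_simps)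
  hence \<alpha>1: "\<alpha> + 1 \<ge> 1" using lnN by linarith
  \<comment> \<open>All factors of \<open>E\<close> are at least \<open>1\<close>, as \<open>ln 3 \<ge> 1\<close>.\<close>
  define E where "E = (\<epsilon>\<^sub>N + 1) * (s\<^sub>N + 1) * (ln (\<epsilon>\<^sub>N + 3) * ln (s\<^sub>N + 3))"
  have "1 * 1 * (1 * 1) \<le> E"
    unfolding E_def using se ln_ge_1 by (intro mult_mono) auto
  hence "60 * real k * (\<alpha> + 1)^2 * 1 \<le> 60 * real k * (\<alpha> + 1)^2 * E"
    by (intro mult_left_mono) auto
  also have "\<dots> \<le> X / ln X ^ 4" using assms(10) by (simp add: E_def mult_ac)
  also have "\<dots> \<le> X / 1"
    using X ln_ge_1[of X] by (intro divide_left_mono one_le_power) auto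
  finally have X1: "60 * real k * (\<alpha> + 1)^2 \<le> X" by simp
  have "60 * real k * (\<alpha> + 1) \<le> 60 * real k * (\<alpha> + 1)^2"
    using \<alpha>1 by (intro mult_left_mono) (auto simp: power2_eq_square)
  moreover have "real k * (60 * (2606 + 248 * ln (real N))) \<le> real k * (60 * (\<alpha> + 1))"
    using \<alpha> by (intro mult_left_mono) auto
  moreover have "real k * (2 * (2 * (1 + ln (real N)) + 1)) \<le> real k * (60 * (2606 + 248 * ln (real N)))"
    using lnN by (intro mult_left_mono) auto
  ultimately have X2: "real k * (2 * (2 * (1 + ln (real N)) + 1)) \<le> X" using X1 by linarith
  obtain R where R: "covers_cosets (2 * N) R" "real (card R) \<le> real (2 * N) * (2 * ln (real (2 * N)) + 1)"
    using covers_cosets_card_le[of "2 * N"] N by auto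
  have "ln (real (2 * N)) \<le> 1 + ln (real N)"
    using N ln_le_minus_one[of "2::real"] by (simp add: ln_mult)
  hence "real (2 * N) * (2 * ln (real (2 * N)) + 1) \<le> real (2 * N) * (2 * (1 + ln (real N)) + 1)"
    by (intro mult_left_mono) auto
  hence "real k * real (card R) \<le> real k * (real (2 * N) * (2 * (1 + ln (real N)) + 1))"
    using R(2) by (intro mult_left_mono) auto
  also have "\<dots> = real N * (real k * (2 * (2 * (1 + ln (real N)) + 1)))" by simp
  also have "\<dots> \<le> real N * X" using X2 by (intro mult_left_mono) auto
  also have "\<dots> \<le> real n" by (rule assms(8))
  finally have "real (k * card R) \<le> real n" by simp
  hence "k * card R \<le> n" by (simp only: of_nat_le_iff)
  hence kn: "k * card R \<le> n + 1" by simp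
  have "1 * 1 \<le> real N * X" using N X by (intro mult_mono) auto
  hence n: "n > 0" using assms(8) by (intro Nat.gr0I) auto
  show ?thesis
    using n modular_form_zero_of_coeffs[OF _ N k R(1) kn]
    by (intro hecke_algebra_eq_span[OF k N]) (auto simp: zero_fun_def)
qed

end
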